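(* A continuous image of an Eberlein compact space is Eberlein compact; a continuous image of a Talagrand compact space is Talagrand compact; and a continuous image of a Gul'ko compact space is Gul'ko compact.
   Context: All spaces (including the image spaces) are Tychonoff (completely regular Hausdorff). A compact space $K$ is Eberlein compact if it is homeomorphic to a weakly compact subset of a Banach space; Talagrand compact if the Banach space $C(K)$ is weakly $K$-analytic (equivalently $C_p(K)$, the space of continuous real functions with the pointwise topology, is $K$-analytic); Gul'ko compact if $C(K)$ is weakly countably determined (equivalently $C_p(K)$ is a Lindelöf $\Sigma$-space). *)

theory Defs
  imports "HOL-Analysis.Analysis" "HOL-Probability.Discrete_Topology"
begin

text \<open>
  A compact space \<open>K\<close> is a type of class \<^class>\<open>t2_space\<close> whose universe is compact; compact
  Hausdorff spaces are normal, so complete regularity need not be required separately.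
  Every continuous real function on such a \<open>K\<close> is bounded, so \<open>C(K)\<close> with the supremum norm is
  the library type \<^typ>\<open>'k::t2_space \<Rightarrow>\<^sub>C real\<close>.
\<close>

definition weak_topology :: "'e::real_normed_vector topology" where
  "weak_topology =
     topology_generated_by {blinfun_apply \<phi> -` U | (\<phi> :: 'e \<Rightarrow>\<^sub>L real) U. open U}"

lemma topspace_weak_topology [simp]: "topspace weak_topology = UNIV"
proof -
  have "blinfun_apply 0 -` (UNIV :: real set)
          \<in> {blinfun_apply \<phi> -` U | (\<phi> :: 'a \<Rightarrow>\<^sub>L real) U. open U}"
    by blast
  then show ?thesis
    unfolding weak_topology_def topology_generated_by_topspace by auto
qed

text \<open>
  Upper semicontinuous compact-valued maps from \<open>P\<close> onto \<open>X\<close>. Empty values are allowed; this does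
  not affect the two notions below, as upper semicontinuity makes the set of points with
  nonempty value closed in \<open>P\<close>.
\<close>

definition usco_onto :: "'p topology \<Rightarrow> 'a topology \<Rightarrow> ('p \<Rightarrow> 'a set) \<Rightarrow> bool" where
  "usco_onto P X \<Phi> \<longleftrightarrow>
     (\<forall>p \<in> topspace P. compactin X (\<Phi> p)) \<and>
     (\<forall>U. openin X U \<longrightarrow> openin P {p \<in> topspace P. \<Phi> p \<subseteq> U}) \<and>
     (\<Union>p \<in> topspace P. \<Phi> p) = topspace X"

text \<open>
  The Baire space is \<^typ>\<open>nat \<Rightarrow> nat\<close>, whose type-class topology is the product of the discrete
  topologies. Countably determined spaces are also called Lindelof \<open>\<Sigma>\<close>-spaces.
\<close>

definition K_analytic :: "'a topology \<Rightarrow> bool" where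
  "K_analytic X \<longleftrightarrow> (\<exists>\<Phi>. usco_onto (euclidean :: (nat \<Rightarrow> nat) topology) X \<Phi>)"

definition countably_determined :: "'a topology \<Rightarrow> bool" where
  "countably_determined X \<longleftrightarrow>
     (\<exists>(P :: (nat \<Rightarrow> nat) set) \<Phi>. usco_onto (top_of_set P) X \<Phi>)"

text \<open>
  HOL cannot quantify existentially over types, so the Banach space \<open>'e\<close> whose weakly compact
  subsets are considered is an explicit parameter. In a hypothesis \<open>'e\<close> is a type variable, i.e.
  an arbitrary Banach space; in a conclusion a concrete one has to be named.
  It suffices to consider the space \<open>\<ell>\<^sup>\<infinity>(K \<times> \<nat>)\<close>: the closed linear span of a weakly
  compact copy of \<open>K\<close> has density character at most the cardinality of \<open>K \<times> \<nat>\<close>,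
  hence embeds isometrically (and so weakly homeomorphically) into \<open>\<ell>\<^sup>\<infinity>(K \<times> \<nat>)\<close> by means of
  a norming family of functionals.
\<close>

definition eberlein_compact_in :: "'e::banach itself \<Rightarrow> 'k::t2_space itself \<Rightarrow> bool" where
  "eberlein_compact_in TYPE('e) TYPE('k) \<longleftrightarrow>
     compact (UNIV :: 'k set) \<and>
     (\<exists>S :: 'e set. compactin weak_topology S \<and>
        (euclidean :: 'k topology) homeomorphic_space subtopology weak_topology S)"

instance bcontfun :: (metric_space, banach) banach ..

type_synonym 'i l_infinity = "'i discrete \<Rightarrow>\<^sub>C real"

definition talagrand_compact :: "'k::t2_space itself \<Rightarrow> bool" where
  "talagrand_compact TYPE('k) \<longleftrightarrow>
     compact (UNIV :: 'k set) \<and> K_analytic (weak_topology :: ('k \<Rightarrow>\<^sub>C real) topology)"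

definition gulko_compact :: "'k::t2_space itself \<Rightarrow> bool" where
  "gulko_compact TYPE('k) \<longleftrightarrow>
     compact (UNIV :: 'k set) \<and> countably_determined (weak_topology :: ('k \<Rightarrow>\<^sub>C real) topology)"

end

theory Submission
  imports Defs
begin

text \<open>
Let \<open>f\<close> map the compact space \<open>K\<close> onto \<open>L\<close>.

\<^bold>\<open>Talagrand and Gul'ko compacta.\<close> Composition with \<open>f\<close> embeds \<open>C(L)\<close> isometrically into \<open>C(K)\<close>. Its range
consists of the functions that are constant on the fibres of \<open>f\<close> and is therefore weakly closed
(\<open>closedin_range_pullback\<close>); by the Hahn-Banach theorem the weak topology of \<open>C(L)\<close> is the one
induced from \<open>C(K)\<close>. So an upper semicontinuous compact-valued map onto \<open>C(K)\<close> can be pulled back to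
\<open>C(L)\<close> (\<open>usco_onto_weak_topology_preimage\<close>).

\<^bold>\<open>Eberlein compacta.\<close> Here closed subspaces are of no direct help, since weak compact generation of
\<open>C(K)\<close> does not pass to them. A weaker property does. The dual unit ball induces a pointwise compact
set of functions on \<open>K\<close> that separates points; sums and products give countably many pointwise
compact sets of continuous functions with a uniformly dense union (\<open>ring_levels_dense\<close>). For each
\<open>\<epsilon>\<close>, their \<open>\<epsilon>\<close>-neighbourhoods cover \<open>C(K)\<close>, and the functions on \<open>L\<close> whose composition with \<open>f\<close> lies
in such a neighbourhood form pointwise compact sets whose members are continuous up to \<open>2\<epsilon>\<close>
(\<open>eps_compact_cover_of_image\<close>). From this alone one constructs on \<open>L\<close> a \<open>\<sigma>\<close>-point-finite family of
continuous functions that separates points (\<open>sigma_point_finite_separating_functions\<close>), and such a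
family maps \<open>L\<close> homeomorphically onto a weakly compact subset of \<open>c\<^sub>0(L \<times> \<nat>)\<close>
(\<open>eberlein_compact_if_sigma_point_finite\<close>). In particular the construction contains a proof of the
theorem of Amir and Lindenstrauss.

The family is built along a projectional resolution. A set of functions and points that is closed
under countably many finitary choices comes with a retraction of \<open>L\<close> onto the closure of its points
which preserves the values of its functions (\<open>indist_core_exists\<close>, \<open>indist_core_unique\<close>). By induction
on cardinality such a set is exhausted by a well-ordered chain of smaller ones, each with its own
separating family; from the functions of each stage one subtracts their composition with the
retraction of the preceding stages. What makes the union of the resulting families point-finite is
a double limit argument: among the increments that lie in one of the compact sets of functions, only
those from finitely many stages are large at a given point (\<open>no_unbounded_escape\<close>).
\<close>

section \<open>Pointwise compact sets of functions\<close>

lemma compact_imp_closed_functions: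
  fixes S :: "('i \<Rightarrow> 'x::t2_space) set"
  assumes "compact S" shows "closed S"
proof -
  have "Hausdorff_space (product_topology (\<lambda>i::'i. euclidean :: 'x topology) UNIV)"
    unfolding Hausdorff_space_product_topology
    by (auto simp: Hausdorff_space_def disjnt_def) (metis hausdorff)
  then have "closedin (euclidean :: ('i \<Rightarrow> 'x) topology) S"
    using assms by (intro compactin_imp_closedin) (simp_all add: euclidean_product_topology)
  then show ?thesis by simp
qed

lemma compact_functions_into_compacts:
  fixes K :: "'i \<Rightarrow> 'x::topological_space set"
  assumes "\<And>i. compact (K i)"
  shows "compact {f. \<forall>i. f i \<in> K i}"
proof -
  have "compactin (product_topology (\<lambda>i. euclidean) UNIV) (PiE UNIV K)"
    using assms by (simp add: compactin_PiE)
  moreover have "PiE UNIV K = {f. \<forall>i. f i \<in> K i}" by (auto simp: PiE_def)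
  ultimately show ?thesis
    by (simp add: euclidean_product_topology)
qed

text \<open>
Since \<open>R\<close> is a strict linear order on \<open>B\<close> without a last element, the tails
\<open>xs ` {j \<in> B. R i j}\<close> have the finite intersection property. Such an index set stands in for
a sequence; it spares the choice of a cofinal sequence of indices.
\<close>
lemma common_cluster_point:
  fixes xs :: "'i \<Rightarrow> 'x::topological_space"
  assumes "compact K" "B \<noteq> {}" "\<And>i. i \<in> B \<Longrightarrow> xs i \<in> K"
    and nomax: "\<And>i. i \<in> B \<Longrightarrow> \<exists>j\<in>B. R i j"
    and trans: "\<And>i j k. \<lbrakk>i \<in> B; j \<in> B; k \<in> B; R i j; R j k\<rbrakk> \<Longrightarrow> R i k"
    and total: "\<And>i j. \<lbrakk>i \<in> B; j \<in> B\<rbrakk> \<Longrightarrow> i = j \<or> R i j \<or> R j i"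
  shows "\<exists>x\<in>K. \<forall>i\<in>B. x \<in> closure (xs ` {j \<in> B. R i j})"
proof -
  let ?T = "\<lambda>i. closure (xs ` {j \<in> B. R i j})"
  have up: "\<exists>m\<in>B. \<forall>i\<in>I. R i m" if "finite I" "I \<subseteq> B" for I
    using that
  proof (induction I)
    case empty
    then show ?case using \<open>B \<noteq> {}\<close> by auto
  next
    case (insert i I)
    then obtain m where m: "m \<in> B" "\<forall>j\<in>I. R j m" by auto
    consider "i = m \<or> R m i" | "R i m"
      using total insert.prems m(1) by blast
    then show ?case
    proof cases
      case 1
      obtain k where "k \<in> B" "R i k" using nomax insert.prems by blast
      with 1 m insert.prems show ?thesis
        by (intro bexI[of _ k]) (blast intro: trans)+
    next
      case 2
      then show ?thesis using m by auto
    qed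
  qed
  have "K \<inter> \<Inter> (?T ` B) \<noteq> {}"
  proof (rule compact_imp_fip_image[OF \<open>compact K\<close>])
    fix I assume "finite I" "I \<subseteq> B"
    then obtain m where m: "m \<in> B" "\<forall>i\<in>I. R i m" using up by blast
    then have "xs m \<in> xs ` {j \<in> B. R i j}" if "i \<in> I" for i using that by auto
    then have "xs m \<in> K \<inter> \<Inter> (?T ` I)"
      using assms(3)[OF m(1)] closure_subset by fastforce
    then show "K \<inter> \<Inter> (?T ` I) \<noteq> {}" by auto
  qed auto
  then show ?thesis by auto
qed

text \<open>
The points \<open>(\<phi> i y)\<^sub>i\<close> lie in a finite power of the real line, which is separable: for
each rational point and each radius one nearby \<open>y\<close> is picked, if there is one.
\<close>
lemma countable_approximating_subset:
  fixes \<phi> :: "'i \<Rightarrow> 'y \<Rightarrow> real"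
  assumes "finite F"
  shows "\<exists>C\<subseteq>Y. countable C \<and> (\<forall>y\<in>Y. \<forall>e>0. \<exists>c\<in>C. \<forall>i\<in>F. \<bar>\<phi> i c - \<phi> i y\<bar> < e)"
proof -
  define near where "near = (\<lambda>q k c. c \<in> Y \<and> (\<forall>i\<in>F. \<bar>\<phi> i c - q i\<bar> < inverse (real (Suc k))))"
  define C where "C = (\<lambda>(q,k). SOME c. near q k c) ` {(q,k). q \<in> PiE F (\<lambda>_. \<rat>) \<and> (\<exists>c. near q k c)}"
  have sel: "near q k (SOME c. near q k c)" if "near q k c" for q k c
    using that by (rule someI)
  have "countable (PiE F (\<lambda>_. \<rat>::real set))"
    using assms countable_rat by (intro countable_PiE)
  then have "countable (PiE F (\<lambda>_. \<rat>::real set) \<times> (UNIV::nat set))" by auto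
  then have "countable C"
    unfolding C_def by (intro countable_image) (rule countable_subset[rotated], auto)
  moreover have "C \<subseteq> Y"
    using sel unfolding C_def near_def by auto
  moreover have "\<exists>c\<in>C. \<forall>i\<in>F. \<bar>\<phi> i c - \<phi> i y\<bar> < e" if "y \<in> Y" "e > 0" for y e
  proof -
    obtain k where k: "inverse (real (Suc k)) < e / 2"
      using reals_Archimedean[of "e/2"] \<open>e > 0\<close> by auto
    have "\<exists>q\<in>\<rat>. \<bar>\<phi> i y - q\<bar> < inverse (real (Suc k))" for i
    proof -
      have "\<phi> i y - inverse (real (Suc k)) < \<phi> i y" by simp
      from Rats_dense_in_real[OF this]
      obtain q where "q \<in> \<rat>" "\<phi> i y - inverse (real (Suc k)) < q" "q < \<phi> i y" by blast
      then show ?thesis by (intro bexI[of _ q]) auto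
    qed
    then obtain q0 where q0: "\<And>i. q0 i \<in> \<rat>" "\<And>i. \<bar>\<phi> i y - q0 i\<bar> < inverse (real (Suc k))"
      by metis
    define q where "q = restrict q0 F"
    have "near q k y" using \<open>y \<in> Y\<close> q0 by (auto simp: near_def q_def)
    then have "q \<in> PiE F (\<lambda>_. \<rat>) \<and> (\<exists>c. near q k c)"
      using q0(1) by (auto simp: q_def)
    then have c: "near q k (SOME c. near q k c)" "(SOME c. near q k c) \<in> C"
      unfolding C_def by (auto intro!: sel simp: image_iff)
    show ?thesis
    proof (intro bexI[OF _ c(2)] ballI)
      fix i assume "i \<in> F"
      then show "\<bar>\<phi> i (SOME c. near q k c) - \<phi> i y\<bar> < e"
        using c(1) q0(2)[of i] k unfolding near_def q_def by fastforce
    qed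
  qed
  ultimately show ?thesis by blast
qed

section \<open>Hulls under finitary operations\<close>

text \<open>
Closure under the operations that a finite set \<open>F\<close> of elements feeds into \<open>G F\<close>. When every
\<open>G F\<close> is countable this is the algebraic counterpart of taking an elementary submodel.
\<close>
inductive_set finitary_hull :: "('s set \<Rightarrow> 's set) \<Rightarrow> 's set \<Rightarrow> 's set"
  for G X where
  base: "x \<in> X \<Longrightarrow> x \<in> finitary_hull G X"
| step: "finite F \<Longrightarrow> (\<forall>z\<in>F. z \<in> finitary_hull G X) \<Longrightarrow> y \<in> G F \<Longrightarrow> y \<in> finitary_hull G X"

lemma finitary_hull_mono:
  assumes "X \<subseteq> Y" shows "finitary_hull G X \<subseteq> finitary_hull G Y"
proof
  fix x assume "x \<in> finitary_hull G X"
  then show "x \<in> finitary_hull G Y"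
    by induction (use assms in \<open>auto intro: finitary_hull.intros\<close>)
qed

lemma finitary_hull_finite_support:
  assumes "x \<in> finitary_hull G X"
  shows "\<exists>F\<subseteq>X. finite F \<and> x \<in> finitary_hull G F"
  using assms
proof induction
  case (base x)
  then show ?case by (intro exI[of _ "{x}"]) (auto intro: finitary_hull.base)
next
  case (step F y)
  then obtain S where S: "\<And>z. z \<in> F \<Longrightarrow> S z \<subseteq> X \<and> finite (S z) \<and> z \<in> finitary_hull G (S z)"
    by metis
  have "\<forall>z\<in>F. z \<in> finitary_hull G (\<Union>(S ` F))"
    using S finitary_hull_mono[of _ "\<Union>(S ` F)" G] by blast
  then have "y \<in> finitary_hull G (\<Union>(S ` F))"
    using step.hyps by (auto intro: finitary_hull.step)
  moreover have "\<Union>(S ` F) \<subseteq> X" "finite (\<Union>(S ` F))" using S step.hyps by auto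
  ultimately show ?case by blast
qed

lemma countable_finitary_hull:
  assumes "countable X" and G: "\<And>F. finite F \<Longrightarrow> countable (G F)"
  shows "countable (finitary_hull G X)"
proof -
  define S where "S = rec_nat X (\<lambda>_ T. T \<union> \<Union> (G ` {F. finite F \<and> F \<subseteq> T}))"
  have S0: "S 0 = X" and SS: "\<And>n. S (Suc n) = S n \<union> \<Union> (G ` {F. finite F \<and> F \<subseteq> S n})"
    by (auto simp: S_def)
  have "countable (S n)" for n
  proof (induction n)
    case (Suc n)
    then have "countable {F. finite F \<and> F \<subseteq> S n}" by (rule countable_Collect_finite_subset)
    then show ?case using Suc G by (auto simp: SS)
  qed (use assms S0 in auto)
  then have "countable (\<Union>n. S n)" by auto
  moreover have inc: "S m \<subseteq> S n" if "m \<le> n" for m n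
    using that by (rule lift_Suc_mono_le[rotated]) (auto simp: SS)
  have "x \<in> (\<Union>n. S n)" if "x \<in> finitary_hull G X" for x
    using that
  proof induction
    case (base x)
    then show ?case using S0 by (auto intro!: exI[of _ 0])
  next
    case (step F y)
    then obtain N where N: "\<And>z. z \<in> F \<Longrightarrow> z \<in> S (N z)" by (metis UN_E)
    have "N z \<le> Max (N ` F)" if "z \<in> F" for z using that step.hyps by simp
    then have "F \<subseteq> S (Max (N ` F))" using N inc by blast
    then have "y \<in> S (Suc (Max (N ` F)))" using step.hyps by (auto simp: SS)
    then show ?case by blast
  qed
  ultimately show ?thesis by (meson countable_subset subsetI)
qed

section \<open>Retractions onto the cores of elementary sets\<close>

text \<open>
Compact Hausdorff spaces are normal, so this is an instance of Urysohn's lemma.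
\<close>
lemma compact_t2_separating_function:
  fixes x y :: "'b::t2_space"
  assumes "compact (UNIV :: 'b set)" "x \<noteq> y"
  obtains g :: "'b \<Rightarrow> real" where "continuous_on UNIV g" "g x = 0" "g y = 1"
proof -
  have "Hausdorff_space (euclidean :: 'b topology)"
    by (auto simp: Hausdorff_space_def disjnt_def) (metis hausdorff)
  moreover have "compact_space (euclidean :: 'b topology)"
    using assms(1) by (simp add: compact_space_def)
  ultimately have "normal_space (euclidean :: 'b topology)"
    by (simp add: compact_Hausdorff_or_regular_imp_normal_space)
  then obtain g where "continuous_map euclidean (top_of_set {0..1::real}) g" "g ` {x} \<subseteq> {0}" "g ` {y} \<subseteq> {1}"
    using Urysohn_lemma[of euclidean "{x}" "{y}" 0 "1::real"] assms(2)
    by (auto simp: disjnt_def)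
  then show ?thesis
    by (intro that[of g]) (auto simp: continuous_map_in_subtopology)
qed

text \<open>
For each \<open>m\<close> the continuous functions are covered by countably many pointwise compact sets
\<open>H m n\<close>. Limits of continuous functions in \<open>H m n\<close> need not be continuous, but by \<open>osc\<close> they
are continuous up to an error of order \<open>1 / Suc m\<close>. This is what remains of weak compact
generation of \<open>C(K)\<close> on a continuous image of \<open>K\<close>, and it is the only property of Eberlein
compacta that the construction of a separating family uses.
\<close>
locale eps_compact_cover =
  fixes H :: "nat \<Rightarrow> nat \<Rightarrow> ('b::t2_space \<Rightarrow> real) set"
  assumes compact_space: "compact (UNIV :: 'b set)"
    and compact_H: "compact (H m n)"
    and cover: "continuous_on UNIV h \<Longrightarrow> \<exists>n. h \<in> H m n"
    and osc: "\<lbrakk>g \<in> H m n; x \<in> closure Y; \<forall>y\<in>Y. \<bar>g y - c\<bar> \<le> \<delta>\<rbrakk> \<Longrightarrow> \<bar>g x - c\<bar> \<le> \<delta> + 1 / real (Suc m)"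
begin

text \<open>
A set \<open>M\<close> in the disjoint sum records at once a set of functions (left summand) and a set of
points (right summand), so that both can be closed off by one hull operation.
\<close>
definition funs :: "(('b \<Rightarrow> real) + 'b) set \<Rightarrow> ('b \<Rightarrow> real) set" where
  "funs M = {a. continuous_on UNIV a \<and> Inl a \<in> M}"

definition core :: "(('b \<Rightarrow> real) + 'b) set \<Rightarrow> 'b set" where
  "core M = closure {d. Inr d \<in> M}"

definition indist :: "(('b \<Rightarrow> real) + 'b) set \<Rightarrow> 'b \<Rightarrow> 'b \<Rightarrow> bool" where
  "indist M x y \<longleftrightarrow> (\<forall>a\<in>funs M. a x = a y)"

definition approximates_points :: "('b \<Rightarrow> real) set \<Rightarrow> 'b set \<Rightarrow> bool" where
  "approximates_points A D \<longleftrightarrow> (\<forall>x. \<forall>e>0. \<exists>d\<in>D. \<forall>a\<in>A. \<bar>a d - a x\<bar> < e)"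

definition approximates_functions :: "'b set \<Rightarrow> ('b \<Rightarrow> real) set \<Rightarrow> bool" where
  "approximates_functions D A \<longleftrightarrow>
     (\<forall>m n. \<forall>g\<in>H m n. continuous_on UNIV g \<longrightarrow>
        (\<forall>e>0. \<exists>a\<in>A \<inter> H m n. continuous_on UNIV a \<and> (\<forall>d\<in>D. \<bar>a d - g d\<bar> < e)))"

text \<open>
The closure conditions of an elementary submodel that matter here: finitely many functions of
\<open>M\<close> do not tell an arbitrary point from a point of \<open>M\<close>, and finitely many points of \<open>M\<close> do
not tell an arbitrary continuous member of \<open>H m n\<close> from a function of \<open>M\<close> in the same \<open>H m n\<close>.
\<close>
definition elementary :: "(('b \<Rightarrow> real) + 'b) set \<Rightarrow> bool" where
  "elementary M \<longleftrightarrow>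
     (\<forall>A. finite A \<longrightarrow> Inl ` A \<subseteq> M \<longrightarrow> approximates_points A {d. Inr d \<in> M}) \<and>
     (\<forall>D. finite D \<longrightarrow> Inr ` D \<subseteq> M \<longrightarrow> approximates_functions D {a. Inl a \<in> M})"

lemma indist_sym: "indist M x y \<Longrightarrow> indist M y x"
  by (auto simp: indist_def)

lemma indist_trans: "indist M x y \<Longrightarrow> indist M y z \<Longrightarrow> indist M x z"
  by (auto simp: indist_def)

lemma indist_antimono: "M \<subseteq> N \<Longrightarrow> indist N x y \<Longrightarrow> indist M x y"
  by (auto simp: indist_def funs_def)

lemma core_mono: "M \<subseteq> N \<Longrightarrow> core M \<subseteq> core N"
  unfolding core_def by (rule closure_mono) auto

lemma compact_core: "compact (core M)"
  using closed_Int_compact[OF closed_closure compact_space] by (simp add: core_def)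

text \<open>
By compactness of the core it suffices to match finitely many functions of \<open>M\<close> approximately.
\<close>
lemma indist_core_exists:
  assumes "elementary M"
  shows "\<exists>d\<in>core M. indist M x d"
proof -
  define C where "C = (\<lambda>(a,k). {d. \<bar>a d - a x\<bar> \<le> inverse (real (Suc k))})"
  have "core M \<inter> \<Inter> (C ` (funs M \<times> UNIV)) \<noteq> {}"
  proof (rule compact_imp_fip_image[OF compact_core])
    fix i assume "i \<in> funs M \<times> (UNIV :: nat set)"
    then show "closed (C i)"
      unfolding C_def case_prod_unfold
      by (intro closed_Collect_le continuous_intros) (auto simp: funs_def)
  next
    fix I assume I: "finite I" "I \<subseteq> funs M \<times> (UNIV :: nat set)"
    define k where "k = Max (insert 0 (snd ` I))"
    have "finite (fst ` I)" "Inl ` fst ` I \<subseteq> M" using I by (auto simp: funs_def)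
    then have "approximates_points (fst ` I) {d. Inr d \<in> M}"
      using assms unfolding elementary_def by blast
    moreover have "inverse (real (Suc k)) > 0" by simp
    ultimately obtain d where d: "Inr d \<in> M" "\<forall>a\<in>fst ` I. \<bar>a d - a x\<bar> < inverse (real (Suc k))"
      unfolding approximates_points_def by blast
    have "d \<in> C i" if "i \<in> I" for i
    proof -
      obtain a l where i: "i = (a, l)" by (cases i)
      have "l \<in> insert 0 (snd ` I)" using that i by force
      then have "l \<le> k" unfolding k_def using I by (intro Max_ge) auto
      then have "inverse (real (Suc k)) \<le> inverse (real (Suc l))" by simp
      moreover have "\<bar>a d - a x\<bar> < inverse (real (Suc k))" using d(2) that i by force
      ultimately have "\<bar>a d - a x\<bar> \<le> inverse (real (Suc l))" by linarith
      then show ?thesis by (simp add: C_def i)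
    qed
    moreover have "d \<in> core M"
      unfolding core_def by (rule closure_subset[THEN subsetD]) (simp add: d(1))
    ultimately show "core M \<inter> \<Inter> (C ` I) \<noteq> {}" by blast
  qed
  then obtain d where d: "d \<in> core M" "\<And>a k. a \<in> funs M \<Longrightarrow> \<bar>a d - a x\<bar> \<le> inverse (real (Suc k))"
    by (auto simp: C_def)
  have "a x = a d" if "a \<in> funs M" for a
  proof (rule ccontr)
    assume "a x \<noteq> a d"
    then obtain k where "inverse (real (Suc k)) < \<bar>a d - a x\<bar>"
      using reals_Archimedean[of "\<bar>a d - a x\<bar>"] by auto
    with d(2)[OF that, of k] show False by simp
  qed
  with d(1) show ?thesis by (auto simp: indist_def)
qed

text \<open>
A continuous \<open>g\<close> that separates \<open>d\<close> from \<open>d'\<close> lies in some \<open>H m n\<close>. On the points of \<open>M\<close> it is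
a limit of functions of \<open>M\<close> in \<open>H m n\<close>; a cluster point \<open>h\<close> of these agrees with \<open>g\<close> on the
points of \<open>M\<close>, hence nearly so on the core by \<open>osc\<close>, but cannot separate \<open>d\<close> from \<open>d'\<close>
because no function of \<open>M\<close> does.
\<close>
lemma indist_core_unique:
  assumes el: "elementary M" and d: "d \<in> core M" "d' \<in> core M" "indist M d d'"
  shows "d = d'"
proof (rule ccontr)
  assume "d \<noteq> d'"
  obtain g :: "'b \<Rightarrow> real" where g: "continuous_on UNIV g" "g d = 0" "g d' = 1"
    by (rule compact_t2_separating_function[OF compact_space \<open>d \<noteq> d'\<close>])
  \<comment> \<open>the level 7 makes the errors in \<open>near\<close> below add up to 1/8 + 1/8, less than half the gap between
    \<open>g d = 0\<close> and \<open>g d' = 1\<close>\<close>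
  obtain n where n: "g \<in> H 7 n" using cover[OF g(1)] by blast
  let ?D = "{y. Inr y \<in> M}"
  define C where "C = (\<lambda>(y,k). {h :: 'b \<Rightarrow> real. h d = h d' \<and> \<bar>h y - g y\<bar> \<le> inverse (real (Suc k))})"
  have "H 7 n \<inter> \<Inter> (C ` (?D \<times> UNIV)) \<noteq> {}"
  proof (rule compact_imp_fip_image[OF compact_H])
    fix i :: "'b \<times> nat"
    show "closed (C i)"
      unfolding C_def case_prod_unfold
      by (rule closed_Collect_conj;
          intro closed_Collect_eq closed_Collect_le continuous_on_rabs continuous_on_diff
            continuous_on_const continuous_on_product_coordinates)
  next
    fix I assume I: "finite I" "I \<subseteq> ?D \<times> (UNIV :: nat set)"
    define k where "k = Max (insert 0 (snd ` I))"
    have "finite (fst ` I)" "Inr ` fst ` I \<subseteq> M" using I by auto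
    then have "approximates_functions (fst ` I) {a. Inl a \<in> M}"
      using el unfolding elementary_def by blast
    moreover have "inverse (real (Suc k)) > 0" by simp
    ultimately obtain a where a: "Inl a \<in> M" "a \<in> H 7 n" "continuous_on UNIV a"
        "\<forall>y\<in>fst ` I. \<bar>a y - g y\<bar> < inverse (real (Suc k))"
      using n g(1) unfolding approximates_functions_def by blast
    have "a d = a d'" using a d(3) by (auto simp: indist_def funs_def)
    have "a \<in> C i" if "i \<in> I" for i
    proof -
      obtain y l where i: "i = (y, l)" by (cases i)
      have "l \<in> insert 0 (snd ` I)" using that i by force
      then have "l \<le> k" unfolding k_def using I by (intro Max_ge) auto
      then have "inverse (real (Suc k)) \<le> inverse (real (Suc l))" by simp
      moreover have "\<bar>a y - g y\<bar> < inverse (real (Suc k))" using a(4) that i by force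
      ultimately have "\<bar>a y - g y\<bar> \<le> inverse (real (Suc l))" by linarith
      then show ?thesis using \<open>a d = a d'\<close> by (simp add: C_def i)
    qed
    then show "H 7 n \<inter> \<Inter> (C ` I) \<noteq> {}" using a(2) by blast
  qed
  then obtain h where "h \<in> H 7 n" and hC: "\<And>i. i \<in> ?D \<times> UNIV \<Longrightarrow> h \<in> C i"
    by blast
  then have h: "h \<in> H 7 n" "\<And>y k. y \<in> ?D \<Longrightarrow> h d = h d' \<and> \<bar>h y - g y\<bar> \<le> inverse (real (Suc k))"
    using hC[of "(_, _)"] by (auto simp: C_def)
  have hg: "h y = g y" if "y \<in> ?D" for y
  proof (rule ccontr)
    assume "h y \<noteq> g y"
    then obtain k where "inverse (real (Suc k)) < \<bar>h y - g y\<bar>"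
      using reals_Archimedean[of "\<bar>h y - g y\<bar>"] by auto
    with h(2)[OF that, of k] show False by simp
  qed
  have near: "\<bar>h z - g z\<bar> \<le> 1 / 4" if "z \<in> core M" for z
  proof -
    let ?U = "{y. \<bar>g y - g z\<bar> < 1 / 8}"
    have "open ?U" using g(1) by (intro open_Collect_less continuous_intros)
    then have "z \<in> closure (?U \<inter> ?D)"
      using open_Int_closure_subset[of ?U ?D] that by (auto simp: core_def)
    then have "\<bar>h z - g z\<bar> \<le> 1 / 8 + 1 / real (Suc 7)"
      by (rule osc[OF h(1)]) (auto simp: hg)
    then show ?thesis by simp
  qed
  have "?D \<noteq> {}" using d(1) closure_empty unfolding core_def by (metis empty_iff)
  then have "h d = h d'" using h(2) by blast
  with near[OF d(1)] near[OF d(2)] g show False by (simp add: abs_if split: if_splits)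
qed

text \<open>
The retraction onto the core that moves no value of a function of \<open>M\<close>. The maps
\<open>g \<mapsto> g \<circ> retr M\<close>, for growing \<open>M\<close>, form a projectional resolution of the identity
of the space of continuous functions.
\<close>
definition retr :: "(('b \<Rightarrow> real) + 'b) set \<Rightarrow> 'b \<Rightarrow> 'b" where
  "retr M x = (THE d. d \<in> core M \<and> indist M x d)"

lemma retr:
  assumes "elementary M"
  shows retr_core: "retr M x \<in> core M" and retr_indist: "indist M x (retr M x)"
proof -
  have "\<exists>!d. d \<in> core M \<and> indist M x d"
    using indist_core_exists[OF assms] indist_core_unique[OF assms] indist_sym indist_trans
    by metis
  from theI'[OF this] show "retr M x \<in> core M" "indist M x (retr M x)"
    unfolding retr_def by auto
qed

lemma retr_unique:
  assumes "elementary M" "d \<in> core M" "indist M x d"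
  shows "retr M x = d"
  using indist_core_unique[OF assms(1) retr_core[OF assms(1)] assms(2)]
    indist_trans[OF indist_sym[OF retr_indist[OF assms(1)]] assms(3)] by blast

lemma retr_cong:
  assumes "elementary M" "indist M x y"
  shows "retr M x = retr M y"
  using assms retr_core retr_indist retr_unique indist_trans by metis

lemma retr_fix:
  assumes "elementary M" "d \<in> core M"
  shows "retr M d = d"
  using assms by (intro retr_unique) (auto simp: indist_def)

text \<open>
The function \<open>Q\<close> below maps a point to its values under \<open>funs M\<close>. It is injective on the compact
core and has the same image there as on the whole space, and \<open>retr M\<close> is \<open>Q\<close> followed by the
inverse of its restriction to the core.
\<close>
lemma continuous_retr:
  assumes el: "elementary M"
  shows "continuous_on UNIV (retr M)"
proof -
  define Q where "Q = (\<lambda>x a. if a \<in> funs M then a x else 0 :: real)"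
  have "continuous_on UNIV (\<lambda>x. Q x a)" for a
    by (cases "a \<in> funs M") (auto simp: Q_def funs_def)
  then have Q: "continuous_on UNIV Q"
    by (rule continuous_on_coordinatewise_then_product)
  have Q_eq: "Q x = Q y \<longleftrightarrow> indist M x y" for x y
    unfolding Q_def indist_def fun_eq_iff by auto
  have "closed (retr M -` C)" if "closed C" for C
  proof -
    have "compact (Q ` (core M \<inter> C))"
      using Q that by (intro compact_continuous_image compact_Int_closed compact_core)
        (auto intro: continuous_on_subset)
    then have "closed (Q -` (Q ` (core M \<inter> C)))"
      using Q by (intro closed_vimage compact_imp_closed_functions)
    moreover have "Q -` (Q ` (core M \<inter> C)) = retr M -` C"
      using retr_core[OF el] retr_indist[OF el] retr_unique[OF el]
      by (auto simp: image_iff Q_eq) blast+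
    ultimately show ?thesis by simp
  qed
  then show ?thesis by (simp add: continuous_on_closed_vimage)
qed

text \<open>
The double limit argument. Let \<open>p i = retr (N i) x\<close>, and let \<open>q\<close> and \<open>g\<close> be cluster points of the
families \<open>p\<close> and \<open>h\<close>. For \<open>j\<close> beyond \<open>i\<close> the point \<open>p j\<close> has the same \<open>N' i\<close>-values as \<open>x\<close>, so
\<open>h i (p j) = h i x\<close>, which is large, and hence \<open>g q\<close> is large. For \<open>i\<close> beyond \<open>j\<close> the point \<open>p j\<close>
lies in the core of \<open>N i\<close>, so \<open>h i (p j) = 0\<close>; thus \<open>g\<close> vanishes at every \<open>p j\<close>, and by \<open>osc\<close> it
is small at \<open>q\<close>.
\<close>
lemma no_unbounded_escape:
  assumes B: "B \<noteq> {}" and nomax: "\<And>i. i \<in> B \<Longrightarrow> \<exists>j\<in>B. R i j"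
    and trans: "\<And>i j k. \<lbrakk>i \<in> B; j \<in> B; k \<in> B; R i j; R j k\<rbrakk> \<Longrightarrow> R i k"
    and total: "\<And>i j. \<lbrakk>i \<in> B; j \<in> B\<rbrakk> \<Longrightarrow> i = j \<or> R i j \<or> R j i"
    and mono: "\<And>i j. \<lbrakk>i \<in> B; j \<in> B; R i j\<rbrakk> \<Longrightarrow> N' i \<subseteq> N j" "\<And>i. i \<in> B \<Longrightarrow> N i \<subseteq> N' i"
    and el: "\<And>i. i \<in> B \<Longrightarrow> elementary (N i)"
    and h: "\<And>i. i \<in> B \<Longrightarrow> h i \<in> H m n" "\<And>i. i \<in> B \<Longrightarrow> continuous_on UNIV (h i)"
      "\<And>i y z. \<lbrakk>i \<in> B; indist (N' i) y z\<rbrakk> \<Longrightarrow> h i y = h i z"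
      "\<And>i d. \<lbrakk>i \<in> B; d \<in> core (N i)\<rbrakk> \<Longrightarrow> h i d = 0"
    and big: "\<And>i. i \<in> B \<Longrightarrow> \<bar>h i x\<bar> > 2 / real (Suc m)"
  shows False
proof -
  define p where "p = (\<lambda>i. retr (N i) x)"
  have "\<exists>q\<in>UNIV. \<forall>i\<in>B. q \<in> closure (p ` {j \<in> B. R i j})"
    by (rule common_cluster_point[OF compact_space B UNIV_I nomax trans total])
  then obtain q where q: "\<And>i. i \<in> B \<Longrightarrow> q \<in> closure (p ` {j \<in> B. R i j})"
    by blast
  have "\<exists>g\<in>H m n. \<forall>i\<in>B. g \<in> closure (h ` {j \<in> B. R i j})"
    by (rule common_cluster_point[OF compact_H B h(1) nomax trans total])
  then obtain g where g: "g \<in> H m n" "\<And>i. i \<in> B \<Longrightarrow> g \<in> closure (h ` {j \<in> B. R i j})"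
    by blast
  have hq: "h i q = h i x" if "i \<in> B" for i
  proof -
    have "closed {y. h i y = h i x}"
      using h(2)[OF that] by (intro closed_Collect_eq continuous_intros)
    moreover have "p ` {j \<in> B. R i j} \<subseteq> {y. h i y = h i x}"
    proof clarsimp
      fix j assume j: "j \<in> B" "R i j"
      have "indist (N' i) x (p j)"
        using indist_antimono[OF mono(1)[OF that j]] retr_indist[OF el[OF j(1)]] by (simp add: p_def)
      then show "h i (p j) = h i x" using h(3)[OF that] by metis
    qed
    ultimately show ?thesis using q[OF that] closure_minimal by blast
  qed
  have gp: "g (p j) = 0" if "j \<in> B" for j
  proof -
    have "closed {f :: 'b \<Rightarrow> real. f (p j) = 0}"
      by (intro closed_Collect_eq continuous_intros continuous_on_product_coordinates)
    moreover have "h ` {i \<in> B. R j i} \<subseteq> {f. f (p j) = 0}"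
    proof clarsimp
      fix i assume i: "i \<in> B" "R j i"
      have "N j \<subseteq> N i" using mono that i by blast
      then have "p j \<in> core (N i)"
        using core_mono[of "N j" "N i"] retr_core[OF el[OF that]] by (auto simp: p_def)
      then show "h i (p j) = 0" using h(4) i by blast
    qed
    ultimately show ?thesis using g(2)[OF that] closure_minimal by blast
  qed
  obtain i where i: "i \<in> B" using B by blast
  have "\<bar>g q - 0\<bar> \<le> 0 + 1 / real (Suc m)"
    by (rule osc[OF g(1) q[OF i]]) (auto simp: gp)
  moreover have "\<bar>g q\<bar> \<ge> 2 / real (Suc m)"
  proof -
    have "closed {f :: 'b \<Rightarrow> real. 2 / real (Suc m) \<le> \<bar>f q\<bar>}"
      by (intro closed_Collect_le continuous_intros continuous_on_product_coordinates)
    moreover have "h ` {j \<in> B. R i j} \<subseteq> {f. 2 / real (Suc m) \<le> \<bar>f q\<bar>}"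
      using hq big by (auto intro: less_imp_le)
    ultimately show ?thesis using g(2)[OF i] closure_minimal by blast
  qed
  moreover have "1 / real (Suc m) < 2 / real (Suc m)" by (simp add: divide_strict_right_mono)
  ultimately show False by linarith
qed

end

section \<open>Point-finite separating families\<close>

text \<open>
An initial piece of order type \<open>\<omega>\<close>: the elements of \<open>B\<close> with only finitely many elements of \<open>B\<close>
before them.
\<close>
lemma infinite_wellordered_unbounded_subset:
  assumes wo: "well_order_on X r" and B: "B \<subseteq> X" "infinite B"
  obtains S where "S \<subseteq> B" "S \<noteq> {}" "\<And>i. i \<in> S \<Longrightarrow> \<exists>j\<in>S. (i, j) \<in> r \<and> i \<noteq> j"
proof -
  have wr: "wo_rel r"
    using wo by (simp add: wo_rel_def well_order_on_Well_order)
  note ANTISYM = wo_rel.ANTISYM[OF wr] and REFL = wo_rel.REFL[OF wr]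
    and TRANS = wo_rel.TRANS[OF wr] and TOTALS = wo_rel.TOTALS[OF wr]
  have X: "Field r = X" using well_order_on_Field[OF wo] by simp
  have least: "\<exists>t\<in>T. \<forall>u\<in>T. (t, u) \<in> r" if "T \<subseteq> X" "T \<noteq> {}" for T
    using wo_rel.minim_in[OF wr, of T] wo_rel.minim_least[OF wr, of T] that X by blast
  have rfl: "(i, i) \<in> r" if "i \<in> X" for i
    using REFL that X by (auto simp: refl_on_def)
  define S where "S = {b \<in> B. finite (B \<inter> under r b)}"
  have "S \<noteq> {}"
  proof -
    have "B \<noteq> {}" using B by auto
    then obtain b where b: "b \<in> B" "\<forall>u\<in>B. (b, u) \<in> r" using least B by blast
    then have "B \<inter> under r b \<subseteq> {b}"
      using ANTISYM by (auto simp: under_def antisym_def)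
    then have "b \<in> S" using b(1) by (auto simp: S_def intro: finite_subset)
    then show ?thesis by auto
  qed
  moreover have "\<exists>j\<in>S. (i, j) \<in> r \<and> i \<noteq> j" if "i \<in> S" for i
  proof -
    have "B - under r i \<noteq> {}"
    proof
      assume "B - under r i = {}"
      then have "B \<inter> under r i = B" by auto
      then show False using that B by (simp add: S_def)
    qed
    then obtain j where j: "j \<in> B - under r i" "\<forall>u\<in>B - under r i. (j, u) \<in> r"
      using least[of "B - under r i"] B by blast
    have "B \<inter> under r j \<subseteq> insert j (B \<inter> under r i)"
      using j ANTISYM by (auto simp: under_def antisym_def)
    then have "j \<in> S" using that j(1) by (auto simp: S_def intro: finite_subset)
    moreover have "i \<in> X" "j \<in> X" using that j(1) B by (auto simp: S_def)
    then have "i \<noteq> j" "(i, j) \<in> r"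
      using j(1) rfl[of i] TOTALS X by (auto simp: under_def)
    ultimately show ?thesis by blast
  qed
  ultimately show ?thesis by (intro that[of S]) (auto simp: S_def)
qed

text \<open>
Soft thresholding: values of modulus at most \<open>2 / Suc m\<close> become 0. It turns the finiteness of
the number of large values into point-finiteness, and for \<open>m\<close> tending to infinity nothing is lost.
\<close>
definition shrink :: "nat \<Rightarrow> real \<Rightarrow> real" where
  "shrink m t = max 0 (t - 2 / real (Suc m)) + min 0 (t + 2 / real (Suc m))"

lemma shrink_eq_0_iff: "shrink m t = 0 \<longleftrightarrow> \<bar>t\<bar> \<le> 2 / real (Suc m)"
proof -
  have "0 < 2 / real (Suc m)" by simp
  then show ?thesis unfolding shrink_def by (auto simp: max_def min_def abs_if)
qed

lemma continuous_on_shrink: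
  "continuous_on S h \<Longrightarrow> continuous_on S (\<lambda>x. shrink m (h x))"
  unfolding shrink_def by (intro continuous_intros)

lemma shrinks_determine:
  assumes "\<And>m. shrink m s = shrink m t" shows "s = t"
proof -
  have lim: "(\<lambda>m. shrink m u) \<longlonglongrightarrow> u" for u
  proof -
    have "(\<lambda>m. shrink m u) \<longlonglongrightarrow> max 0 (u - 0) + min 0 (u + 0)"
      unfolding shrink_def
      by (intro tendsto_intros LIMSEQ_Suc[OF lim_const_over_n])
    moreover have "max 0 (u - 0) + min 0 (u + 0) = u" by (simp add: max_def min_def)
    ultimately show ?thesis by (simp only:)
  qed
  show ?thesis using lim[of s] lim[of t] assms LIMSEQ_unique by (metis (no_types, lifting) ext)
qed

context eps_compact_cover
begin

lemma countable_witnesses_exist: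
  assumes "finite F"
  shows "\<exists>C. countable C \<and> approximates_points {a. Inl a \<in> F} {d. Inr d \<in> C} \<and>
     approximates_functions {d. Inr d \<in> F} {a. Inl a \<in> C}"
proof -
  have fin: "finite {a. Inl a \<in> F}" "finite {d. Inr d \<in> F}"
    using finite_vimageI[OF assms, of Inl] finite_vimageI[OF assms, of Inr] by (auto simp: vimage_def)
  obtain P where P: "countable P" "\<forall>x\<in>UNIV. \<forall>e>0. \<exists>d\<in>P. \<forall>a\<in>{a. Inl a \<in> F}. \<bar>a d - a x\<bar> < e"
    using countable_approximating_subset[OF fin(1), of UNIV "\<lambda>a x. a x"] by blast
  define good where "good = (\<lambda>m n A. A \<subseteq> {g \<in> H m n. continuous_on UNIV g} \<and> countable A \<and>
      (\<forall>g\<in>{g \<in> H m n. continuous_on UNIV g}. \<forall>e>0. \<exists>a\<in>A. \<forall>d\<in>{d. Inr d \<in> F}. \<bar>a d - g d\<bar> < e))"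
  have "\<exists>A. good m n A" for m n
    unfolding good_def by (rule countable_approximating_subset[OF fin(2), of _ "\<lambda>d g. g d"])
  then obtain A where "\<And>m n. good m n (A m n)" by metis
  note this[unfolded good_def]
  note A = this[THEN conjunct1] this[THEN conjunct2, THEN conjunct1] this[THEN conjunct2, THEN conjunct2]
  let ?C = "Inr ` P \<union> Inl ` (\<Union>m n. A m n)"
  have sets: "{d. Inr d \<in> ?C} = P" "{a. Inl a \<in> ?C} = (\<Union>m n. A m n)" by auto
  have "countable ?C" using P(1) A(2) by auto
  moreover have "approximates_points {a. Inl a \<in> F} P"
    unfolding approximates_points_def using P(2) by blast
  moreover have "approximates_functions {d. Inr d \<in> F} (\<Union>m n. A m n)"
    unfolding approximates_functions_def
  proof (intro allI ballI impI)
    fix m n g e assume g: "g \<in> H m n" "continuous_on UNIV g" and "(e::real) > 0"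
    then obtain a where "a \<in> A m n" "\<forall>d\<in>{d. Inr d \<in> F}. \<bar>a d - g d\<bar> < e"
      using A(3) by blast
    then show "\<exists>a\<in>(\<Union>m n. A m n) \<inter> H m n. continuous_on UNIV a \<and> (\<forall>d\<in>{d. Inr d \<in> F}. \<bar>a d - g d\<bar> < e)"
      using A(1) by blast
  qed
  ultimately show ?thesis by (intro exI[of _ ?C]) (simp only: sets)
qed

text \<open>
Skolem functions for \<open>elementary\<close>, with countably many values for each finite set of parameters.
\<close>
definition witnesses :: "(('b \<Rightarrow> real) + 'b) set \<Rightarrow> (('b \<Rightarrow> real) + 'b) set" where
  "witnesses F = (SOME C. countable C \<and> approximates_points {a. Inl a \<in> F} {d. Inr d \<in> C} \<and>
     approximates_functions {d. Inr d \<in> F} {a. Inl a \<in> C})"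

lemma witnesses:
  assumes "finite F"
  shows "countable (witnesses F)" "approximates_points {a. Inl a \<in> F} {d. Inr d \<in> witnesses F}"
    "approximates_functions {d. Inr d \<in> F} {a. Inl a \<in> witnesses F}"
  using someI_ex[OF countable_witnesses_exist[OF assms]] unfolding witnesses_def by auto

lemma approximates_points_mono:
  "approximates_points A D \<Longrightarrow> D \<subseteq> D' \<Longrightarrow> approximates_points A D'"
  unfolding approximates_points_def by fast

lemma approximates_functions_mono:
  assumes "approximates_functions D A" "A \<subseteq> A'"
  shows "approximates_functions D A'"
proof -
  have "A \<inter> H m n \<subseteq> A' \<inter> H m n" for m n using assms(2) by blast
  then show ?thesis
    using assms(1) unfolding approximates_functions_def by (meson subsetD)
qed

abbreviation skolem_hull :: "(('b \<Rightarrow> real) + 'b) set \<Rightarrow> (('b \<Rightarrow> real) + 'b) set" where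
  "skolem_hull \<equiv> finitary_hull witnesses"

lemma elementary_skolem_hull: "elementary (skolem_hull X)"
proof -
  let ?M = "skolem_hull X"
  have sub: "witnesses F \<subseteq> ?M" if "finite F" "F \<subseteq> ?M" for F
    using that by (auto intro: finitary_hull.step)
  have "approximates_points A {d. Inr d \<in> ?M}" if "finite A" "Inl ` A \<subseteq> ?M" for A
  proof -
    have "approximates_points A {d. Inr d \<in> witnesses (Inl ` A)}"
      using witnesses(2)[of "Inl ` A"] that(1) by (simp add: image_iff)
    moreover have "{d. Inr d \<in> witnesses (Inl ` A)} \<subseteq> {d. Inr d \<in> ?M}"
      using sub[of "Inl ` A"] that by auto
    ultimately show ?thesis by (rule approximates_points_mono)
  qed
  moreover have "approximates_functions D {a. Inl a \<in> ?M}" if "finite D" "Inr ` D \<subseteq> ?M" for D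
  proof -
    have "approximates_functions D {a. Inl a \<in> witnesses (Inr ` D)}"
      using witnesses(3)[of "Inr ` D"] that(1) by (simp add: image_iff)
    moreover have "{a. Inl a \<in> witnesses (Inr ` D)} \<subseteq> {a. Inl a \<in> ?M}"
      using sub[of "Inr ` D"] that by auto
    ultimately show ?thesis by (rule approximates_functions_mono)
  qed
  ultimately show ?thesis unfolding elementary_def by blast
qed

lemma countable_skolem_hull: "countable X \<Longrightarrow> countable (skolem_hull X)"
  using witnesses(1) by (intro countable_finitary_hull)

text \<open>
The hull is finitary, so each of its functions already appears in the hull of a finite subset.
This replaces the continuity at limit stages of a projectional resolution.
\<close>
lemma indist_skolem_hullI:
  assumes "\<And>F. \<lbrakk>finite F; F \<subseteq> X\<rbrakk> \<Longrightarrow> indist (skolem_hull F) x y"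
  shows "indist (skolem_hull X) x y"
  unfolding indist_def
proof
  fix a assume a: "a \<in> funs (skolem_hull X)"
  then obtain F where "F \<subseteq> X" "finite F" "Inl a \<in> skolem_hull F"
    using finitary_hull_finite_support[of "Inl a" witnesses X] by (auto simp: funs_def)
  then show "a x = a y"
    using assms[of F] a by (auto simp: indist_def funs_def)
qed

text \<open>
A function that factors through the hull of \<open>under r i\<close> and vanishes on the core of the hull of
\<open>underS r i\<close> is an increment at stage \<open>i\<close>. Within a fixed \<open>H m n\<close>, only finitely many stages
have an increment that is large at \<open>x\<close>: infinitely many stages would contain a subset without a
last element, against \<open>no_unbounded_escape\<close>.
\<close>
lemma finitely_many_large_increments:
  assumes wo: "well_order_on X r" and "B \<subseteq> X"
    and h: "\<And>i. i \<in> B \<Longrightarrow> \<exists>h\<in>H m n. continuous_on UNIV h \<and>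
      (\<forall>y z. indist (skolem_hull (under r i)) y z \<longrightarrow> h y = h z) \<and>
      (\<forall>d\<in>core (skolem_hull (underS r i)). h d = 0) \<and> \<bar>h x\<bar> > 2 / real (Suc m)"
  shows "finite B"
proof (rule ccontr)
  assume "infinite B"
  then obtain S where S: "S \<subseteq> B" "S \<noteq> {}" and nomax: "\<And>i. i \<in> S \<Longrightarrow> \<exists>j\<in>S. (i, j) \<in> r \<and> i \<noteq> j"
    by (rule infinite_wellordered_unbounded_subset[OF wo \<open>B \<subseteq> X\<close>]) auto
  have "\<forall>i\<in>S. \<exists>h. h \<in> H m n \<and> continuous_on UNIV h \<and>
      (\<forall>y z. indist (skolem_hull (under r i)) y z \<longrightarrow> h y = h z) \<and>
      (\<forall>d\<in>core (skolem_hull (underS r i)). h d = 0) \<and> \<bar>h x\<bar> > 2 / real (Suc m)"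
    using h S(1) by fast
  from bchoice[OF this] obtain h where h: "\<forall>i\<in>S. h i \<in> H m n \<and> continuous_on UNIV (h i) \<and>
      (\<forall>y z. indist (skolem_hull (under r i)) y z \<longrightarrow> h i y = h i z) \<and>
      (\<forall>d\<in>core (skolem_hull (underS r i)). h i d = 0) \<and> \<bar>h i x\<bar> > 2 / real (Suc m)" ..
  have r: "trans r" "antisym r" "total_on X r"
    using wo by (auto simp: well_order_on_def linear_order_on_def partial_order_on_def preorder_on_def)
  have SX: "S \<subseteq> X" using S assms(2) by auto
  show False
  proof (rule no_unbounded_escape[where R = "\<lambda>i j. (i, j) \<in> r \<and> i \<noteq> j" and B = S and h = h and x = x
        and N = "\<lambda>i. skolem_hull (underS r i)" and N' = "\<lambda>i. skolem_hull (under r i)"])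
    show "(i, k) \<in> r \<and> i \<noteq> k" if "(i, j) \<in> r \<and> i \<noteq> j" "(j, k) \<in> r \<and> j \<noteq> k" for i j k
      using that r(1,2) by (meson antisymD transD)
    show "i = j \<or> (i, j) \<in> r \<and> i \<noteq> j \<or> (j, i) \<in> r \<and> j \<noteq> i" if "i \<in> S" "j \<in> S" for i j
      using that SX r(3) by (auto simp: total_on_def)
    show "skolem_hull (under r i) \<subseteq> skolem_hull (underS r j)" if "(i, j) \<in> r \<and> i \<noteq> j" for i j
      using that r(1,2) by (intro finitary_hull_mono) (auto simp: under_def underS_def dest: transD antisymD)
    show "skolem_hull (underS r i) \<subseteq> skolem_hull (under r i)" for i
      by (intro finitary_hull_mono) (auto simp: under_def underS_def)
  qed (use S(2) nomax h elementary_skolem_hull in auto)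
qed

text \<open>
A family split into \<open>'i\<close> many point-finite parts whose members factor through the quotient of
the space by \<open>indist M\<close> and separate its points. For a countable index type such families are
called \<open>\<sigma>\<close>-point-finite.
\<close>
definition point_finite_separating ::
    "(('b \<Rightarrow> real) + 'b) set \<Rightarrow> ('i \<Rightarrow> ('b \<Rightarrow> real) set) \<Rightarrow> bool" where
  "point_finite_separating M \<G> \<longleftrightarrow>
     (\<forall>k. \<forall>g\<in>\<G> k. continuous_on UNIV g \<and> (\<forall>x y. indist M x y \<longrightarrow> g x = g y)) \<and>
     (\<forall>k x. finite {g \<in> \<G> k. g x \<noteq> 0}) \<and>
     (\<forall>x y. (\<forall>k. \<forall>g\<in>\<G> k. g x = g y) \<longrightarrow> indist M x y)"

lemma point_finite_separating_reindex:
  fixes \<G> :: "'i::countable \<Rightarrow> ('b \<Rightarrow> real) set"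
  assumes "point_finite_separating M \<G>"
  shows "point_finite_separating M (\<lambda>k. \<G> (from_nat k))"
proof -
  have "(\<forall>k. \<forall>g\<in>\<G> (from_nat k). g x = g y) \<longleftrightarrow> (\<forall>i. \<forall>g\<in>\<G> i. g x = g y)" for x y
    by (metis from_nat_to_nat)
  then show ?thesis using assms unfolding point_finite_separating_def by simp
qed

lemma point_finite_separating_countable:
  assumes "countable M"
  shows "point_finite_separating M (\<lambda>k. {a \<in> funs M. to_nat_on (funs M) a = k})"
proof -
  have "countable (Inl ` funs M :: (('b \<Rightarrow> real) + 'b) set)"
    using assms by (rule countable_subset[rotated]) (auto simp: funs_def)
  then have "countable (funs M)"
    by (rule countable_image_inj_on) (auto simp: inj_on_def)
  then have inj: "inj_on (to_nat_on (funs M)) (funs M)" by (rule inj_on_to_nat_on)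
  have "finite {a \<in> {a \<in> funs M. to_nat_on (funs M) a = k}. a x \<noteq> 0}" for k x
  proof -
    have "finite (to_nat_on (funs M) -` {k} \<inter> funs M)"
      using inj by (intro finite_vimage_IntI) auto
    then show ?thesis by (rule finite_subset[rotated]) auto
  qed
  then show ?thesis
    unfolding point_finite_separating_def by (auto simp: indist_def funs_def)
qed

text \<open>
Enumerate \<open>X\<close> by a well-order \<open>r\<close>, and let stage \<open>i\<close> be the hull of \<open>under r i\<close>. From a member \<open>g\<close>
of the family given for stage \<open>i\<close> subtract \<open>g \<circ> retr\<close>, where \<open>retr\<close> belongs to the hull of \<open>underS r i\<close>.

The increments, sorted by the set \<open>H m n\<close> to which they belong and then thresholded, are
point-finite: at \<open>x\<close> only finitely many stages matter, and within one stage only the finitely many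
\<open>g\<close> that do not vanish at \<open>x\<close> or at \<open>retr x\<close>. They separate: if \<open>i\<close> is the first stage that tells \<open>x\<close>
from \<open>y\<close>, then \<open>retr x = retr y\<close>, so an increment differs at \<open>x\<close> and \<open>y\<close> as much as \<open>g\<close> does.
\<close>
lemma point_finite_separating_step:
  assumes wo: "well_order_on X r"
    and \<G>: "\<And>i. i \<in> X \<Longrightarrow> point_finite_separating (skolem_hull (under r i)) (\<G> i :: nat \<Rightarrow> _)"
  shows "\<exists>\<G> :: nat \<Rightarrow> _. point_finite_separating (skolem_hull X) \<G>"
proof -
  let ?N = "\<lambda>i. skolem_hull (underS r i)" and ?N' = "\<lambda>i. skolem_hull (under r i)"
  let ?A0 = "funs (skolem_hull {})"
  have wr: "wo_rel r"
    using wo by (simp add: wo_rel_def well_order_on_Well_order)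
  note ANTISYM = wo_rel.ANTISYM[OF wr] and REFL = wo_rel.REFL[OF wr]
    and TRANS = wo_rel.TRANS[OF wr] and TOTALS = wo_rel.TOTALS[OF wr]
  have X: "Field r = X" using well_order_on_Field[OF wo] by simp
  have under_X: "under r i \<subseteq> X" for i using X by (auto simp: under_def Field_def)
  have "underS r i \<subseteq> under r i" "underS r i \<subseteq> X" for i
    using under_X[of i] by (auto simp: under_def underS_def)
  note sub = this(1)[THEN finitary_hull_mono] under_X[THEN finitary_hull_mono]
    this(2)[THEN finitary_hull_mono] empty_subsetI[of X, THEN finitary_hull_mono]
  define incr where "incr = (\<lambda>i g x. g x - g (retr (?N i) x) :: real)"
  \<comment> \<open>The left summand deals with the hull of the empty set, which lies below all stages; it is
    countable, so that its functions can be taken one at a time.\<close>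
  define \<Delta> where "\<Delta> = (\<lambda>s. case s of
      Inl k \<Rightarrow> {a \<in> ?A0. to_nat_on ?A0 a = k}
    | Inr (k, m, n) \<Rightarrow> {(\<lambda>x. shrink m (incr i g x)) | i g. i \<in> X \<and> g \<in> \<G> i k \<and> incr i g \<in> H m n})"
  have base: "point_finite_separating (skolem_hull {}) (\<lambda>k. {a \<in> ?A0. to_nat_on ?A0 a = k})"
    by (intro point_finite_separating_countable countable_skolem_hull) auto
  have cont: "continuous_on UNIV (incr i g)" if "i \<in> X" "g \<in> \<G> i k" for i g k
  proof -
    have g: "continuous_on UNIV g" using \<G> that by (auto simp: point_finite_separating_def)
    then have "continuous_on UNIV (\<lambda>x. g (retr (?N i) x))"
      by (rule continuous_on_compose2[OF _ continuous_retr[OF elementary_skolem_hull]]) auto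
    then show ?thesis unfolding incr_def using g by (intro continuous_intros)
  qed
  have meas: "incr i g x = incr i g y" if "i \<in> X" "g \<in> \<G> i k" "indist (?N' i) x y" for i g k x y
  proof -
    have "g x = g y" using \<G> that by (auto simp: point_finite_separating_def)
    moreover have "retr (?N i) x = retr (?N i) y"
      using that(3) sub(1) by (intro retr_cong elementary_skolem_hull) (rule indist_antimono)
    ultimately show ?thesis by (simp add: incr_def)
  qed
  have 1: "continuous_on UNIV u \<and> (\<forall>x y. indist (skolem_hull X) x y \<longrightarrow> u x = u y)" if u: "u \<in> \<Delta> s" for u s
  proof (cases s)
    case (Inl k)
    then show ?thesis
      using u indist_antimono[OF sub(4)] by (auto simp: \<Delta>_def indist_def funs_def)
  next
    case (Inr t)
    then obtain k m n where s: "s = Inr (k, m, n)" by (cases t) auto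
    then obtain i g where ig: "i \<in> X" "g \<in> \<G> i k" "u = (\<lambda>x. shrink m (incr i g x))"
      using u by (auto simp: \<Delta>_def)
    then have "continuous_on UNIV u"
      using cont by (auto intro: continuous_on_shrink)
    moreover have "u x = u y" if "indist (skolem_hull X) x y" for x y
      using meas[OF ig(1,2) indist_antimono[OF sub(2) that]] ig(3) by simp
    ultimately show ?thesis by blast
  qed
  have 2: "finite {u \<in> \<Delta> s. u x \<noteq> 0}" for s x
  proof (cases s)
    case (Inl k)
    then show ?thesis
      using base by (auto simp: \<Delta>_def point_finite_separating_def)
  next
    case (Inr t)
    then obtain k m n where s: "s = Inr (k, m, n)" by (cases t) auto
    define B where "B = {i \<in> X. \<exists>g\<in>\<G> i k. incr i g \<in> H m n \<and> \<bar>incr i g x\<bar> > 2 / real (Suc m)}"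
    have "finite B"
    proof (rule finitely_many_large_increments[OF wo, of B m n x])
      show "B \<subseteq> X" by (auto simp: B_def)
      fix i assume "i \<in> B"
      then obtain g where g: "i \<in> X" "g \<in> \<G> i k" "incr i g \<in> H m n" "\<bar>incr i g x\<bar> > 2 / real (Suc m)"
        by (auto simp: B_def)
      have "\<forall>d\<in>core (?N i). incr i g d = 0"
        by (simp add: incr_def retr_fix[OF elementary_skolem_hull])
      then show "\<exists>h\<in>H m n. continuous_on UNIV h \<and> (\<forall>y z. indist (?N' i) y z \<longrightarrow> h y = h z) \<and>
          (\<forall>d\<in>core (?N i). h d = 0) \<and> \<bar>h x\<bar> > 2 / real (Suc m)"
        using g cont meas by (intro bexI[of _ "incr i g"]) blast+
    qed
    define Z where "Z = (\<lambda>i. {g \<in> \<G> i k. g x \<noteq> 0} \<union> {g \<in> \<G> i k. g (retr (?N i) x) \<noteq> 0})"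
    have "finite (Z i)" if "i \<in> X" for i
      using \<G>[OF that] by (auto simp: Z_def point_finite_separating_def)
    then have "finite (\<Union>i\<in>B. (\<lambda>g x. shrink m (incr i g x)) ` Z i)"
      using \<open>finite B\<close> by (auto simp: B_def)
    moreover have "{u \<in> \<Delta> s. u x \<noteq> 0} \<subseteq> (\<Union>i\<in>B. (\<lambda>g x. shrink m (incr i g x)) ` Z i)"
    proof
      fix u assume "u \<in> {u \<in> \<Delta> s. u x \<noteq> 0}"
      then obtain i g where ig: "i \<in> X" "g \<in> \<G> i k" "incr i g \<in> H m n"
          "u = (\<lambda>x. shrink m (incr i g x))" "shrink m (incr i g x) \<noteq> 0"
        using s by (auto simp: \<Delta>_def)
      then have big: "\<bar>incr i g x\<bar> > 2 / real (Suc m)" by (simp add: shrink_eq_0_iff)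
      then have "incr i g x \<noteq> 0" by auto
      then have "g \<in> Z i" using ig(2) by (auto simp: Z_def incr_def)
      moreover have "i \<in> B" using ig big by (auto simp: B_def)
      ultimately show "u \<in> (\<Union>i\<in>B. (\<lambda>g x. shrink m (incr i g x)) ` Z i)" using ig(4) by blast
    qed
    ultimately show ?thesis by (rule finite_subset[rotated])
  qed
  have 3: "indist (skolem_hull X) x y" if eq: "\<And>s u. u \<in> \<Delta> s \<Longrightarrow> u x = u y" for x y
  proof -
    have "a x = a y" if "a \<in> ?A0" for a
      using eq[of a "Inl (to_nat_on ?A0 a)"] that by (simp add: \<Delta>_def)
    then have ind0: "indist (skolem_hull {}) x y" by (simp add: indist_def)
    \<comment> \<open>a nonempty finite subset of \<open>X\<close> is contained in \<open>under r i\<close> for its last element \<open>i\<close>\<close>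
    have directed: "indist (skolem_hull Y) x y"
      if Y: "Y \<subseteq> X" "\<And>i. i \<in> Y \<Longrightarrow> indist (?N' i) x y" for Y
    proof (rule indist_skolem_hullI)
      fix F assume F: "finite F" "F \<subseteq> Y"
      show "indist (skolem_hull F) x y"
      proof (cases "F = {}")
        case True
        then show ?thesis using ind0 by simp
      next
        case False
        with F(1) have "\<exists>i\<in>F. F \<subseteq> under r i"
          using subset_trans[OF F(2) Y(1)]
        proof (induction F rule: finite_ne_induct)
          case (singleton a)
          then show ?case using REFL X by (auto simp: under_def refl_on_def)
        next
          case (insert a F)
          then obtain i where i: "i \<in> F" "F \<subseteq> under r i" by auto
          have "(a, i) \<in> r \<or> (i, a) \<in> r" "(a, a) \<in> r"
            using TOTALS REFL X insert.prems i(1) by (auto simp: refl_on_def)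
          then show ?case
          proof (elim conjE disjE)
            assume "(i, a) \<in> r"
            then have "F \<subseteq> under r a" using i(2) transD[OF TRANS] by (force simp: under_def)
            then show ?case using \<open>(a, a) \<in> r\<close> by (auto simp: under_def)
          qed (use i in \<open>auto simp: under_def\<close>)
        qed
        then obtain i where i: "i \<in> F" "F \<subseteq> under r i" by blast
        then show ?thesis
          using Y(2)[of i] F(2) indist_antimono[OF finitary_hull_mono[OF i(2)]] by blast
      qed
    qed
    have levels: "i \<in> X \<longrightarrow> indist (?N' i) x y" for i
    proof (induction i rule: wo_rel.well_order_induct[OF wr])
      case (1 i)
      show ?case
      proof
        assume i: "i \<in> X"
        have "underS r i \<subseteq> X" using under_X[of i] by (auto simp: under_def underS_def)
        then have "indist (?N i) x y"
        proof (rule directed)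
          fix j assume "j \<in> underS r i"
          then show "indist (?N' j) x y"
            using 1 \<open>underS r i \<subseteq> X\<close> by (auto simp: underS_def)
        qed
        then have retr: "retr (?N i) x = retr (?N i) y"
          by (intro retr_cong elementary_skolem_hull)
        have "g x = g y" if g: "g \<in> \<G> i k" for g k
        proof -
          have "incr i g x = incr i g y"
          proof (rule shrinks_determine)
            fix m
            obtain n where "incr i g \<in> H m n" using cover[OF cont[OF i g]] by blast
            then have "(\<lambda>x. shrink m (incr i g x)) \<in> \<Delta> (Inr (k, m, n))"
              using i g by (auto simp: \<Delta>_def)
            from eq[OF this] show "shrink m (incr i g x) = shrink m (incr i g y)" .
          qed
          then show ?thesis by (simp add: incr_def retr)
        qed
        then show "indist (?N' i) x y"
          using \<G>[OF i] unfolding point_finite_separating_def by blast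
      qed
    qed
    show ?thesis by (rule directed[OF subset_refl]) (simp add: levels)
  qed
  have "point_finite_separating (skolem_hull X) \<Delta>"
    unfolding point_finite_separating_def
  proof (intro conjI allI ballI impI)
    fix s u assume u: "u \<in> \<Delta> s"
    show "continuous_on UNIV u" using 1[OF u] ..
    show "u x = u y" if "indist (skolem_hull X) x y" for x y
      using 1[OF u] that by simp
  next
    show "finite {u \<in> \<Delta> s. u x \<noteq> 0}" for s x by (rule 2)
  next
    show "indist (skolem_hull X) x y" if "\<forall>s. \<forall>u\<in>\<Delta> s. u x = u y" for x y
      using that by (intro 3) blast
  qed
  from point_finite_separating_reindex[OF this] show ?thesis by blast
qed

text \<open>
Induction on the cardinality of \<open>X\<close>: an uncountable \<open>X\<close> is well-ordered in the type of its
cardinal, so that all \<open>under |X| i\<close> are of smaller cardinality.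
\<close>
lemma point_finite_separating_skolem_hull:
  includes cardinal_syntax
  shows "\<exists>\<G> :: nat \<Rightarrow> _. point_finite_separating (skolem_hull X) \<G>"
proof (induction X rule: wf_induct_rule[OF wf_inv_image[OF wf_ordLess, of card_of]])
  case (1 X)
  show ?case
  proof (cases "countable X")
    case True
    then show ?thesis
      using point_finite_separating_countable[OF countable_skolem_hull] by blast
  next
    case False
    then have inf: "infinite X" using countable_finite by blast
    have small: "|under |X| i| <o |X|" if "i \<in> X" for i
    proof -
      have i: "|underS |X| i| <o |X|"
        using that by (intro card_of_underS) (auto simp: card_of_card_order_on Field_card_of)
      have "|{i}| <o |X|"
        using inf by (intro finite_ordLess_infinite card_of_Well_order) (auto simp: Field_card_of)
      with i have "|underS |X| i \<union> {i}| <o |X|"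
        using inf by (intro card_of_Un_ordLess_infinite)
      moreover have "under |X| i = underS |X| i \<union> {i}"
        using that Refl_under_underS[of "|X|" i] card_of_Well_order[of X]
        by (auto simp: Field_card_of order_on_defs)
      ultimately show ?thesis by simp
    qed
    have "\<exists>\<G> :: nat \<Rightarrow> _. point_finite_separating (skolem_hull (under |X| i)) \<G>" if "i \<in> X" for i
      using 1 small[OF that] by simp
    then obtain \<G> where "\<And>i. i \<in> X \<Longrightarrow> point_finite_separating (skolem_hull (under |X| i)) (\<G> i :: nat \<Rightarrow> _)"
      by metis
    then show ?thesis by (rule point_finite_separating_step[OF card_of_well_order_on])
  qed
qed

text \<open>
The hull of all functions and all points separates points.
\<close>
theorem sigma_point_finite_separating_functions:
  "\<exists>\<G> :: nat \<Rightarrow> ('b \<Rightarrow> real) set. (\<forall>k. \<forall>g\<in>\<G> k. continuous_on UNIV g) \<and>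
     (\<forall>k x. finite {g \<in> \<G> k. g x \<noteq> 0}) \<and> (\<forall>x y. x \<noteq> y \<longrightarrow> (\<exists>k. \<exists>g\<in>\<G> k. g x \<noteq> g y))"
proof -
  obtain \<G> :: "nat \<Rightarrow> ('b \<Rightarrow> real) set" where \<G>: "point_finite_separating (skolem_hull UNIV) \<G>"
    using point_finite_separating_skolem_hull by blast
  have "skolem_hull UNIV = UNIV" by (auto intro: finitary_hull.base)
  moreover have "x = y" if xy: "indist UNIV x y" for x y
  proof (rule ccontr)
    assume "x \<noteq> y"
    obtain g :: "'b \<Rightarrow> real" where "continuous_on UNIV g" "g x = 0" "g y = 1"
      by (rule compact_t2_separating_function[OF compact_space \<open>x \<noteq> y\<close>])
    then show False using xy by (auto simp: indist_def funs_def)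
  qed
  ultimately show ?thesis
    using \<G> unfolding point_finite_separating_def by (intro exI[of _ \<G>]) metis
qed

end

section \<open>The Hahn-Banach theorem\<close>

definition sublinear :: "('v::real_vector \<Rightarrow> real) \<Rightarrow> bool" where
  "sublinear q \<longleftrightarrow> (\<forall>x y. q (x + y) \<le> q x + q y) \<and> (\<forall>x. \<forall>c>0. q (c *\<^sub>R x) = c * q x)"

lemma sublinear_0: "sublinear q \<Longrightarrow> q 0 = 0"
  unfolding sublinear_def by (metis mult_cancel_right1 scaleR_zero_right zero_less_numeral numeral_eq_one_iff semiring_norm(85))

lemma sublinear_minus:
  assumes "sublinear q" shows "- q (- x) \<le> q x"
proof -
  have "q (x + - x) \<le> q x + q (- x)" using assms unfolding sublinear_def by blast
  then show ?thesis using sublinear_0[OF assms] by simp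
qed

lemma sublinearI:
  assumes "\<And>x y. q (x + y) \<le> q x + q y" "\<And>x c. c > 0 \<Longrightarrow> q (c *\<^sub>R x) \<le> c * q x"
  shows "sublinear q"
  unfolding sublinear_def
proof (intro conjI allI impI)
  fix x :: 'a and c :: real assume c: "c > 0"
  have "q (inverse c *\<^sub>R c *\<^sub>R x) \<le> inverse c * q (c *\<^sub>R x)" using c by (intro assms(2)) simp
  then have "c * q x \<le> q (c *\<^sub>R x)" using c by (simp add: field_simps)
  then show "q (c *\<^sub>R x) = c * q x" using assms(2)[OF c, of x] by simp
qed (fact assms(1))

text \<open>
Zorn's lemma applies because \<open>- p (- x)\<close> is a lower bound, at \<open>x\<close>, of every sublinear functional
below \<open>p\<close>; so the pointwise infimum of a chain exists, and it is again sublinear.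
\<close>
lemma minimal_sublinear_below:
  assumes "sublinear p"
  obtains q :: "'v::real_vector \<Rightarrow> real" where "sublinear q" "\<And>x. q x \<le> p x"
    "\<And>q'. \<lbrakk>sublinear q'; \<And>x. q' x \<le> q x\<rbrakk> \<Longrightarrow> q' = q"
proof -
  define A where "A = {q. sublinear q \<and> q \<le> p}"
  define r where "r = {(q, q'). q \<in> A \<and> q' \<in> A \<and> q' \<le> q}"
  have "\<exists>m\<in>Field r. \<forall>a\<in>Field r. (m, a) \<in> r \<longrightarrow> a = m"
  proof (rule Zorns_po_lemma)
    have "Field r = A" by (auto simp: r_def Field_def)
    then show "Partial_order r"
      unfolding partial_order_on_def preorder_on_def
      by (auto simp: r_def refl_on_def trans_def antisym_def)
    fix C assume C: "C \<in> Chains r"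
    then have CA: "C \<subseteq> A" by (auto simp: Chains_def r_def)
    show "\<exists>u\<in>Field r. \<forall>a\<in>C. (a, u) \<in> r"
    proof (cases "C = {}")
      case True
      then show ?thesis using assms \<open>Field r = A\<close> by (auto simp: A_def)
    next
      case False
      define u where "u = (\<lambda>x. INF q\<in>C. q x)"
      have low: "- p (- x) \<le> q x" if "q \<in> C" for q x
      proof -
        have q: "sublinear q" "q (- x) \<le> p (- x)" using that CA by (auto simp: A_def le_fun_def)
        then show ?thesis using sublinear_minus[of q x] by linarith
      qed
      then have bdd: "bdd_below ((\<lambda>q. q x) ` C)" for x by (intro bdd_belowI2[of _ "- p (- x)"])
      have le: "u x \<le> q x" if "q \<in> C" for q x
        unfolding u_def using bdd that by (rule cINF_lower)
      have glb: "m \<le> u x" if "\<And>q. q \<in> C \<Longrightarrow> m \<le> q x" for m x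
        unfolding u_def using False that by (intro cINF_greatest)
      have tot: "q \<le> q' \<or> q' \<le> q" if "q \<in> C" "q' \<in> C" for q q'
        using that C by (auto simp: Chains_def r_def)
      have "sublinear u"
      proof (rule sublinearI)
        fix x y
        have "u (x + y) - q x \<le> u y" if q: "q \<in> C" for q
        proof (rule glb)
          fix q' assume q': "q' \<in> C"
          obtain q'' where q'': "q'' \<in> C" "q'' \<le> q" "q'' \<le> q'" using tot[OF q q'] q q' by auto
          have "u (x + y) \<le> q'' (x + y)" using le q'' by blast
          also have "\<dots> \<le> q'' x + q'' y" using q''(1) CA by (auto simp: A_def sublinear_def)
          also have "\<dots> \<le> q x + q' y" using q''(2,3) by (intro add_mono) (auto simp: le_fun_def)
          finally show "u (x + y) - q x \<le> q' y" by simp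
        qed
        then have "u (x + y) - u y \<le> q x" if "q \<in> C" for q using that by (simp add: algebra_simps)
        then have "u (x + y) - u y \<le> u x" by (rule glb)
        then show "u (x + y) \<le> u x + u y" by simp
      next
        fix x and c :: real assume c: "c > 0"
        have "u (c *\<^sub>R x) / c \<le> u x"
        proof (rule glb)
          fix q assume q: "q \<in> C"
          have "u (c *\<^sub>R x) \<le> q (c *\<^sub>R x)" using le[OF q] .
          also have "\<dots> = c * q x" using q CA c by (auto simp: A_def sublinear_def)
          finally show "u (c *\<^sub>R x) / c \<le> q x" using c by (simp add: field_simps)
        qed
        then show "u (c *\<^sub>R x) \<le> c * u x" using c by (simp add: field_simps)
      qed
      moreover have "u \<le> p"
      proof (rule le_funI)
        fix x
        obtain q where "q \<in> C" using False by auto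
        then have "q x \<le> p x" using CA by (auto simp: A_def le_fun_def)
        then show "u x \<le> p x" using le[OF \<open>q \<in> C\<close>, of x] by linarith
      qed
      ultimately have "u \<in> A" by (simp add: A_def)
      moreover have "(a, u) \<in> r" if "a \<in> C" for a
        using \<open>u \<in> A\<close> that CA le by (auto simp: r_def le_fun_def)
      ultimately show ?thesis using \<open>Field r = A\<close> by blast
    qed
  qed
  moreover have "Field r = A" by (auto simp: r_def Field_def)
  ultimately obtain m where m: "m \<in> A" "\<And>a. a \<in> A \<Longrightarrow> (m, a) \<in> r \<Longrightarrow> a = m" by auto
  show ?thesis
  proof (rule that[of m])
    show "sublinear m" "m x \<le> p x" for x using m(1) by (auto simp: A_def le_fun_def)
    fix q' assume q': "sublinear q'" "\<And>x. q' x \<le> m x"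
    then have "q' \<le> m" by (simp add: le_fun_def)
    then have "q' \<in> A" using q' m(1) by (auto simp: A_def)
    then show "q' = m" using m \<open>q' \<le> m\<close> by (auto simp: r_def)
  qed
qed

text \<open>
For fixed \<open>z\<close>, the infimum \<open>q'\<close> of \<open>q (x + t z) - t q z\<close> over \<open>t \<ge> 0\<close> is a sublinear functional
below \<open>q\<close>. Minimality gives \<open>q' = q\<close>, and \<open>t = 1\<close> then shows that \<open>q\<close> is superadditive.
\<close>
lemma minimal_sublinear_imp_linear:
  assumes q: "sublinear q" and min: "\<And>q'. \<lbrakk>sublinear q'; \<And>x. q' x \<le> q x\<rbrakk> \<Longrightarrow> q' = q"
  shows "linear q"
proof -
  have sub: "q (x + y) \<le> q x + q y" for x y using q unfolding sublinear_def by blast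
  have hom: "q (c *\<^sub>R x) = c * q x" if "c \<ge> 0" for c x
    using q that sublinear_0[OF q] unfolding sublinear_def by (cases "c = 0") auto
  have add: "q (x + z) = q x + q z" for x z
  proof (rule antisym[OF sub])
    define v where "v = (\<lambda>t x. q (x + t *\<^sub>R z) - t * q z)"
    define q' where "q' = (\<lambda>x. INF t\<in>{0..}. v t x)"
    have low: "- q (- x) \<le> v t x" if "t \<ge> 0" for t x
    proof -
      have "q ((x + t *\<^sub>R z) + - x) \<le> q (x + t *\<^sub>R z) + q (- x)" by (rule sub)
      then show ?thesis using hom[OF that, of z] by (simp add: v_def)
    qed
    then have bdd: "bdd_below ((\<lambda>t. v t x) ` {0..})" for x by (intro bdd_belowI2[of _ "- q (- x)"]) auto
    have le: "q' x \<le> v t x" if "t \<ge> 0" for t x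
      unfolding q'_def using bdd that by (intro cINF_lower) auto
    have glb: "m \<le> q' x" if "\<And>t. t \<ge> 0 \<Longrightarrow> m \<le> v t x" for m x
      unfolding q'_def using that by (intro cINF_greatest) auto
    have "sublinear q'"
    proof (rule sublinearI)
      fix x y
      have "q' (x + y) - v s x \<le> q' y" if s: "s \<ge> 0" for s
      proof (rule glb)
        fix t :: real assume t: "t \<ge> 0"
        have "q' (x + y) \<le> v (s + t) (x + y)" using s t by (intro le) simp
        also have "\<dots> = q ((x + s *\<^sub>R z) + (y + t *\<^sub>R z)) - s * q z - t * q z"
          by (simp add: v_def algebra_simps)
        also have "\<dots> \<le> v s x + v t y" using sub[of "x + s *\<^sub>R z" "y + t *\<^sub>R z"] by (simp add: v_def)
        finally show "q' (x + y) - v s x \<le> v t y" by simp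
      qed
      then have "q' (x + y) - q' y \<le> v s x" if "s \<ge> 0" for s using that by (simp add: algebra_simps)
      then have "q' (x + y) - q' y \<le> q' x" by (rule glb)
      then show "q' (x + y) \<le> q' x + q' y" by simp
    next
      fix x and c :: real assume c: "c > 0"
      have "q' (c *\<^sub>R x) / c \<le> q' x"
      proof (rule glb)
        fix t :: real assume t: "t \<ge> 0"
        have "q' (c *\<^sub>R x) \<le> v (c * t) (c *\<^sub>R x)" using c t by (intro le) simp
        also have "\<dots> = q (c *\<^sub>R (x + t *\<^sub>R z)) - c * t * q z"
          by (simp add: v_def algebra_simps)
        also have "\<dots> = c * v t x" using c by (simp add: v_def hom right_diff_distrib)
        finally show "q' (c *\<^sub>R x) / c \<le> v t x" using c by (simp add: field_simps)
      qed
      then show "q' (c *\<^sub>R x) \<le> c * q' x" using c by (simp add: field_simps)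
    qed
    moreover have "q' x \<le> q x" for x using le[of 0 x] by (simp add: v_def)
    ultimately have "q' = q" by (rule min)
    then show "q x + q z \<le> q (x + z)" using le[of 1 x] by (simp add: v_def)
  qed
  have neg: "q (- x) = - q x" for x using add[of x "- x"] sublinear_0[OF q] by simp
  show ?thesis
  proof (rule linearI)
    show "q (x + y) = q x + q y" for x y by (rule add)
    show "q (c *\<^sub>R x) = c *\<^sub>R q x" for c x
    proof (cases "c \<ge> 0")
      case False
      then have "q (- c *\<^sub>R - x) = - c * q (- x)" by (intro hom) auto
      then show ?thesis by (simp add: neg)
    qed (simp add: hom)
  qed
qed

text \<open>
The Hahn-Banach theorem. The infimum \<open>q\<close> of \<open>\<parallel>\<phi>\<parallel> \<parallel>y - T g\<parallel> + \<phi> g\<close> over \<open>g\<close> is sublinear and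
satisfies \<open>q (T g) \<le> \<phi> g\<close>. A linear functional below \<open>q\<close> is bounded by \<open>\<parallel>\<phi>\<parallel>\<close>, and it agrees with
\<open>\<phi>\<close> along \<open>T\<close> because the inequality also holds at \<open>- g\<close>.
\<close>
lemma extension_along_isometry:
  fixes T :: "'v::real_normed_vector \<Rightarrow> 'w::real_normed_vector" and \<phi> :: "'v \<Rightarrow>\<^sub>L real"
  assumes T: "linear T" "\<And>v. norm (T v) = norm v"
  shows "\<exists>\<psi> :: 'w \<Rightarrow>\<^sub>L real. \<forall>v. blinfun_apply \<psi> (T v) = blinfun_apply \<phi> v"
proof -
  define v where "v = (\<lambda>g y. norm \<phi> * norm (y - T g) + \<phi> g)"
  define q where "q = (\<lambda>y. INF g. v g y)"
  have T_diff: "T (a - b) = T a - T b" and T_add: "T (a + b) = T a + T b" and T_scale: "T (c *\<^sub>R a) = c *\<^sub>R T a" for a b c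
    using T(1) by (simp_all add: linear_diff linear_add linear_scale)
  have "- (norm \<phi> * norm y) \<le> v g y" for g y
  proof -
    have "- \<phi> g \<le> norm \<phi> * norm g" using norm_blinfun[of \<phi> g] by (simp add: abs_le_iff)
    also have "\<dots> = norm \<phi> * norm (y - (y - T g))" by (simp add: T(2))
    also have "\<dots> \<le> norm \<phi> * (norm y + norm (y - T g))"
      by (intro mult_left_mono norm_triangle_ineq4) simp
    finally show ?thesis by (simp add: v_def algebra_simps)
  qed
  then have bdd: "bdd_below (range (\<lambda>g. v g y))" for y by (intro bdd_belowI2[of _ "- (norm \<phi> * norm y)"])
  have le: "q y \<le> v g y" for g y
    unfolding q_def using bdd by (intro cINF_lower) auto
  have glb: "m \<le> q y" if "\<And>g. m \<le> v g y" for m y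
    unfolding q_def using that by (intro cINF_greatest) auto
  have "sublinear q"
  proof (rule sublinearI)
    fix x y
    have "q (x + y) - v g x \<le> q y" for g
    proof (rule glb)
      fix h
      have "q (x + y) \<le> v (g + h) (x + y)" by (rule le)
      also have "\<dots> = norm \<phi> * norm ((x - T g) + (y - T h)) + \<phi> g + \<phi> h"
        by (simp add: v_def T_add blinfun.add_right algebra_simps)
      also have "\<dots> \<le> norm \<phi> * (norm (x - T g) + norm (y - T h)) + \<phi> g + \<phi> h"
        by (intro add_mono mult_left_mono norm_triangle_ineq) auto
      finally show "q (x + y) - v g x \<le> v h y" by (simp add: v_def algebra_simps)
    qed
    then have "q (x + y) - q y \<le> v g x" for g by (simp add: algebra_simps)
    then have "q (x + y) - q y \<le> q x" by (rule glb)
    then show "q (x + y) \<le> q x + q y" by simp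
  next
    fix x and c :: real assume c: "c > 0"
    have "q (c *\<^sub>R x) / c \<le> q x"
    proof (rule glb)
      fix g
      have "q (c *\<^sub>R x) \<le> v (c *\<^sub>R g) (c *\<^sub>R x)" by (rule le)
      also have "\<dots> = norm \<phi> * norm (c *\<^sub>R (x - T g)) + c * \<phi> g"
        by (simp add: v_def T_scale blinfun.scaleR_right algebra_simps)
      also have "\<dots> = c * v g x" using c by (simp add: v_def distrib_left mult.left_commute)
      finally show "q (c *\<^sub>R x) / c \<le> v g x" using c by (simp add: field_simps)
    qed
    then show "q (c *\<^sub>R x) \<le> c * q x" using c by (simp add: field_simps)
  qed
  then obtain m where m: "sublinear m" "\<And>x. m x \<le> q x"
      "\<And>q'. \<lbrakk>sublinear q'; \<And>x. q' x \<le> m x\<rbrakk> \<Longrightarrow> q' = m"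
    by (rule minimal_sublinear_below) blast
  have lin: "linear m" using minimal_sublinear_imp_linear[OF m(1,3)] by blast
  have bound: "m y \<le> norm \<phi> * norm y" for y
    using m(2)[of y] le[of y 0] by (simp add: v_def linear_0[OF T(1)])
  have "norm (m y) \<le> norm y * norm \<phi>" for y
    using bound[of y] bound[of "- y"] by (simp add: linear_neg[OF lin] abs_le_iff mult.commute)
  then have bl: "bounded_linear m"
    using lin by (intro bounded_linear_intro[of m "norm \<phi>"]) (auto simp: linear_add linear_scale)
  have upper: "m (T g) \<le> \<phi> g" for g
    using m(2)[of "T g"] le[of "T g" g] by (simp add: v_def)
  have "m (T g) = \<phi> g" for g
    using upper[of g] upper[of "- g"] by (simp add: linear_neg[OF T(1)] linear_neg[OF lin] blinfun.minus_right)
  then show ?thesis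
    using bl by (intro exI[of _ "Blinfun m"]) (simp add: bounded_linear_Blinfun_apply)
qed

section \<open>The weak topology of a closed subspace\<close>

text \<open>
Together with the continuity of \<open>T\<close>, this says that an isometric embedding is also an embedding
for the weak topologies. It is enough to treat the subbase, where functionals are extended.
\<close>
lemma openin_weak_topology_preimage:
  fixes T :: "'v::real_normed_vector \<Rightarrow> 'w::real_normed_vector"
  assumes T: "linear T" "\<And>v. norm (T v) = norm v" and "openin weak_topology U"
  shows "\<exists>V. openin weak_topology V \<and> U = T -` V"
proof -
  have "generate_topology_on {blinfun_apply \<phi> -` U | (\<phi> :: 'v \<Rightarrow>\<^sub>L real) U. open U} U"
    using assms(3) unfolding weak_topology_def by (rule openin_topology_generated_by)
  then show ?thesis
  proof induction
    case Empty
    then show ?case by (intro exI[of _ "{}"]) auto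
  next
    case (Int a b)
    then obtain V W where "openin weak_topology V" "a = T -` V" "openin weak_topology W" "b = T -` W" by blast
    then show ?case by (intro exI[of _ "V \<inter> W"]) auto
  next
    case (UN K)
    then obtain V where V: "\<And>k. k \<in> K \<Longrightarrow> openin weak_topology (V k) \<and> k = T -` V k" by metis
    then have "openin weak_topology (\<Union>k\<in>K. V k)" by blast
    moreover have "\<Union>K = T -` (\<Union>k\<in>K. V k)" using V by blast
    ultimately show ?case by blast
  next
    case (Basis s)
    then obtain \<phi> :: "'v \<Rightarrow>\<^sub>L real" and O' where s: "s = blinfun_apply \<phi> -` O'" "open O'" by blast
    obtain \<psi> :: "'w \<Rightarrow>\<^sub>L real" where \<psi>: "\<forall>v. blinfun_apply \<psi> (T v) = blinfun_apply \<phi> v"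
      using extension_along_isometry[OF T, of \<phi>] by blast
    have "openin weak_topology (blinfun_apply \<psi> -` O')"
      unfolding weak_topology_def by (rule topology_generated_by_Basis) (use s(2) in blast)
    moreover have "s = T -` (blinfun_apply \<psi> -` O')" using \<psi> by (auto simp: s(1))
    ultimately show ?case by blast
  qed
qed

lemma continuous_map_weak_topology_blinfun:
  "continuous_map weak_topology euclidean (blinfun_apply \<phi> :: _ \<Rightarrow> real)"
  unfolding continuous_map_def
proof (intro conjI allI impI)
  fix U :: "real set" assume "openin euclidean U"
  then have "openin weak_topology (blinfun_apply \<phi> -` U)"
    unfolding weak_topology_def by (intro topology_generated_by_Basis) auto
  then show "openin weak_topology {x \<in> topspace weak_topology. \<phi> x \<in> U}"
    by (simp add: vimage_def)
qed auto

text \<open>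
An open set \<open>U\<close> of the smaller space has the form \<open>T -` V\<close>, and \<open>T -` \<Phi> p \<subseteq> U\<close> says that \<open>\<Phi> p\<close> is
contained in the open set \<open>V \<union> - range T\<close>.
\<close>
lemma usco_onto_weak_topology_preimage:
  fixes T :: "'v::real_normed_vector \<Rightarrow> 'w::real_normed_vector"
  assumes T: "linear T" "\<And>v. norm (T v) = norm v"
    and closed: "closedin weak_topology (range T)"
    and \<Phi>: "usco_onto P weak_topology \<Phi>"
  shows "usco_onto P weak_topology (\<lambda>p. T -` \<Phi> p)"
  unfolding usco_onto_def
proof (intro conjI ballI allI impI)
  fix p assume p: "p \<in> topspace P"
  show "compactin weak_topology (T -` \<Phi> p)"
    unfolding compactin_def
  proof (intro conjI allI impI)
    fix \<U> :: "'v set set"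
    assume \<U>: "Ball \<U> (openin weak_topology) \<and> T -` \<Phi> p \<subseteq> \<Union> \<U>"
    then obtain V where V: "\<And>U. U \<in> \<U> \<Longrightarrow> openin weak_topology (V U) \<and> U = T -` V U"
      using openin_weak_topology_preimage[OF T] by metis
    have "compactin weak_topology (\<Phi> p \<inter> range T)"
      using \<Phi> p closed by (intro compact_Int_closedin) (auto simp: usco_onto_def)
    moreover have "\<Phi> p \<inter> range T \<subseteq> \<Union> (V ` \<U>)"
    proof
      fix y assume "y \<in> \<Phi> p \<inter> range T"
      then obtain g where "y = T g" "g \<in> T -` \<Phi> p" by auto
      then obtain U where "U \<in> \<U>" "g \<in> U" using \<U> by blast
      then show "y \<in> \<Union> (V ` \<U>)" using V \<open>y = T g\<close> by blast
    qed
    ultimately obtain \<F> where \<F>: "finite \<F>" "\<F> \<subseteq> V ` \<U>" "\<Phi> p \<inter> range T \<subseteq> \<Union> \<F>"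
      using V unfolding compactin_def by (metis (no_types, lifting) imageE)
    then obtain \<F>' where \<F>': "finite \<F>'" "\<F>' \<subseteq> \<U>" "\<F> = V ` \<F>'" by (meson finite_subset_image)
    have "T -` \<Phi> p \<subseteq> \<Union> \<F>'"
    proof
      fix g assume "g \<in> T -` \<Phi> p"
      then have "T g \<in> \<Union> (V ` \<F>')" using \<F> \<F>'(3) by auto
      then obtain U where U: "U \<in> \<F>'" "T g \<in> V U" by blast
      then have "g \<in> U" using V[of U] \<F>'(2) by blast
      then show "g \<in> \<Union> \<F>'" using U(1) by blast
    qed
    then show "\<exists>\<F>. finite \<F> \<and> \<F> \<subseteq> \<U> \<and> T -` \<Phi> p \<subseteq> \<Union> \<F>" using \<F>' by blast
  qed simp
next
  fix U :: "'v set" assume "openin weak_topology U"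
  then obtain V where V: "openin weak_topology V" "U = T -` V"
    using openin_weak_topology_preimage[OF T] by blast
  have "openin weak_topology (- range T)"
    using closed by (simp add: closedin_def Compl_eq_Diff_UNIV)
  then have "openin weak_topology (V \<union> - range T)" using V(1) by blast
  then have "openin P {p \<in> topspace P. \<Phi> p \<subseteq> V \<union> - range T}"
    using \<Phi> unfolding usco_onto_def by blast
  moreover have "\<Phi> p \<subseteq> V \<union> - range T \<longleftrightarrow> T -` \<Phi> p \<subseteq> U" for p using V(2) by auto
  ultimately show "openin P {p \<in> topspace P. T -` \<Phi> p \<subseteq> U}" by simp
next
  show "(\<Union>p\<in>topspace P. T -` \<Phi> p) = topspace weak_topology"
  proof -
    have "T x \<in> (\<Union>p\<in>topspace P. \<Phi> p)" for x using \<Phi> by (simp add: usco_onto_def)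
    then show ?thesis by auto
  qed
qed

section \<open>Spaces of continuous functions on continuous images\<close>

lemma closed_image_compact_t2:
  fixes f :: "'a::t2_space \<Rightarrow> 'b::t2_space"
  assumes "compact (UNIV :: 'a set)" "continuous_on UNIV f" "closed C"
  shows "closed (f ` C)"
proof -
  have "compact C" using closed_Int_compact[OF assms(3,1)] by simp
  then show ?thesis
    using assms(2) by (intro compact_imp_closed compact_continuous_image) (auto intro: continuous_on_subset)
qed

lemma continuous_on_compact_quotient:
  fixes f :: "'a::t2_space \<Rightarrow> 'b::t2_space" and g :: "'b \<Rightarrow> 'c::topological_space"
  assumes "compact (UNIV :: 'a set)" "continuous_on UNIV f" "surj f"
    and gf: "continuous_on UNIV (\<lambda>x. g (f x))"
  shows "continuous_on UNIV g"
proof -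
  have "closed (g -` C)" if "closed C" for C
  proof -
    have "closed ((\<lambda>x. g (f x)) -` C)" using gf that by (rule closed_vimage[rotated])
    then have "closed (f ` ((\<lambda>x. g (f x)) -` C))" by (rule closed_image_compact_t2[OF assms(1,2)])
    moreover have "(\<lambda>x. g (f x)) -` C = f -` (g -` C)" by auto
    then have "f ` ((\<lambda>x. g (f x)) -` C) = g -` C"
      by (simp only: surj_image_vimage_eq[OF \<open>surj f\<close>])
    ultimately show ?thesis by simp
  qed
  then show ?thesis by (simp add: continuous_on_closed_vimage)
qed

definition pullback :: "('a::t2_space \<Rightarrow> 'b::t2_space) \<Rightarrow> ('b \<Rightarrow>\<^sub>C real) \<Rightarrow> ('a \<Rightarrow>\<^sub>C real)" where
  "pullback f g = Bcontfun (\<lambda>x. apply_bcontfun g (f x))"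

lemma pullback_apply:
  assumes "continuous_on UNIV f"
  shows "apply_bcontfun (pullback f g) x = apply_bcontfun g (f x)"
proof -
  have "(\<lambda>x. apply_bcontfun g (f x)) \<in> bcontfun"
    unfolding bcontfun_def
  proof (clarsimp, intro conjI)
    show "continuous_on UNIV (\<lambda>x. apply_bcontfun g (f x))"
      by (rule continuous_on_compose2[OF continuous_on_apply_bcontfun assms]) auto
    show "bounded (range (\<lambda>x. apply_bcontfun g (f x)))"
      by (rule bounded_subset[OF bounded_apply_bcontfun[of g]]) auto
  qed
  then show ?thesis by (simp add: pullback_def Bcontfun_inverse)
qed

lemma bounded_linear_apply_bcontfun:
  "bounded_linear (\<lambda>h :: 'a::topological_space \<Rightarrow>\<^sub>C real. apply_bcontfun h x)"
proof (rule bounded_linear_intro[where K = 1])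
  show "norm (apply_bcontfun h x) \<le> norm h * 1" for h :: "'a \<Rightarrow>\<^sub>C real"
    using norm_bounded[of h x] by simp
qed auto

text \<open>
The range of \<open>pullback f\<close> consists of the functions that are constant on the fibres of \<open>f\<close>. So it
is an intersection of kernels of differences of two evaluations, and these are weakly closed.
\<close>
lemma pullback:
  assumes K: "compact (UNIV :: 'a::t2_space set)" and f: "continuous_on UNIV (f :: 'a \<Rightarrow> 'b::t2_space)" "surj f"
  shows linear_pullback: "linear (pullback f)"
    and norm_pullback: "norm (pullback f g) = norm g"
    and closedin_range_pullback: "closedin weak_topology (range (pullback f))"
proof -
  note app = pullback_apply[OF f(1)]
  show "linear (pullback f)"
    by (rule linearI) (auto intro!: bcontfun_eqI simp: app)
  show "norm (pullback f g) = norm g"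
  proof (rule antisym)
    show "norm (pullback f g) \<le> norm g"
      by (rule norm_bound) (simp only: app norm_bounded)
    show "norm g \<le> norm (pullback f g)"
    proof (rule norm_bound)
      fix y obtain x where "y = f x" using f(2) by blast
      then show "norm (apply_bcontfun g y) \<le> norm (pullback f g)"
        using norm_bounded[of "pullback f g" x] by (simp add: app)
    qed
  qed
  let ?E = "\<lambda>(x, x'). {h :: 'a \<Rightarrow>\<^sub>C real. apply_bcontfun h x - apply_bcontfun h x' = 0}"
  have "closedin weak_topology (?E (x, x'))" for x x'
  proof -
    have "bounded_linear (\<lambda>h :: 'a \<Rightarrow>\<^sub>C real. apply_bcontfun h x - apply_bcontfun h x')"
      by (intro bounded_linear_sub bounded_linear_apply_bcontfun)
    then have "closedin weak_topology {h \<in> topspace weak_topology. Blinfun (\<lambda>h :: 'a \<Rightarrow>\<^sub>C real. apply_bcontfun h x - apply_bcontfun h x') h \<in> {0}}"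
      by (intro closedin_continuous_map_preimage[OF continuous_map_weak_topology_blinfun]) auto
    then show ?thesis
      using \<open>bounded_linear _\<close> by (simp add: bounded_linear_Blinfun_apply)
  qed
  then have "closedin weak_topology (\<Inter> (?E ` {(x, x'). f x = f x'}))"
    by (intro closedin_Inter) auto
  moreover have "\<Inter> (?E ` {(x, x'). f x = f x'}) = range (pullback f)"
  proof (intro equalityI subsetI)
    fix h assume fibres: "h \<in> \<Inter> (?E ` {(x, x'). f x = f x'})"
    have h: "apply_bcontfun h x = apply_bcontfun h x'" if "f x = f x'" for x x'
    proof -
      have "(x, x') \<in> {(x, x'). f x = f x'}" using that by simp
      from INT_D[OF fibres this] show ?thesis by simp
    qed
    define g where "g = (\<lambda>y. apply_bcontfun h (inv f y))"
    have gf: "g (f x) = apply_bcontfun h x" for x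
      unfolding g_def using f(2) by (intro h) (simp add: surj_f_inv_f)
    have "continuous_on UNIV g"
      by (rule continuous_on_compact_quotient[OF K f]) (simp add: gf)
    moreover have "range g = range h" using gf f(2) by (metis (no_types, lifting) image_cong image_image)
    then have "bounded (range g)" by simp
    ultimately have "g \<in> bcontfun" by (simp add: bcontfun_def)
    then have "h = pullback f (Bcontfun g)"
      by (intro bcontfun_eqI) (simp add: app Bcontfun_inverse gf)
    then show "h \<in> range (pullback f)" by blast
  qed (auto simp: app)
  ultimately show "closedin weak_topology (range (pullback f))" by simp
qed

theorem talagrand_compact_image:
  assumes f: "continuous_on UNIV (f :: 'a::t2_space \<Rightarrow> 'b::t2_space)" "surj f" and "talagrand_compact TYPE('a)"
  shows "talagrand_compact TYPE('b)"
proof -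
  have K: "compact (UNIV :: 'a set)" using assms(3) by (simp add: talagrand_compact_def)
  then have "compact (UNIV :: 'b set)" using f compact_continuous_image by metis
  moreover obtain \<Phi> where "usco_onto (euclidean :: (nat \<Rightarrow> nat) topology) (weak_topology :: ('a \<Rightarrow>\<^sub>C real) topology) \<Phi>"
    using assms(3) by (auto simp: talagrand_compact_def K_analytic_def)
  from usco_onto_weak_topology_preimage[OF pullback[OF K f] this]
  have "K_analytic (weak_topology :: ('b \<Rightarrow>\<^sub>C real) topology)" by (auto simp: K_analytic_def)
  ultimately show ?thesis by (simp add: talagrand_compact_def)
qed

theorem gulko_compact_image:
  assumes f: "continuous_on UNIV (f :: 'a::t2_space \<Rightarrow> 'b::t2_space)" "surj f" and "gulko_compact TYPE('a)"
  shows "gulko_compact TYPE('b)"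
proof -
  have K: "compact (UNIV :: 'a set)" using assms(3) by (simp add: gulko_compact_def)
  then have "compact (UNIV :: 'b set)" using f compact_continuous_image by metis
  moreover obtain P :: "(nat \<Rightarrow> nat) set" and \<Phi> where "usco_onto (top_of_set P) (weak_topology :: ('a \<Rightarrow>\<^sub>C real) topology) \<Phi>"
    using assms(3) by (auto simp: gulko_compact_def countably_determined_def)
  from usco_onto_weak_topology_preimage[OF pullback[OF K f] this]
  have "countably_determined (weak_topology :: ('b \<Rightarrow>\<^sub>C real) topology)" by (auto simp: countably_determined_def)
  ultimately show ?thesis by (simp add: gulko_compact_def)
qed

section \<open>Eberlein compacta and their images have compact covers of functions\<close>

text \<open>
The Banach-Alaoglu theorem, with the dual ball viewed as a set of functions.
\<close>
lemma compact_dual_ball: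
  "compact {L :: 'e::real_normed_vector \<Rightarrow> real. linear L \<and> (\<forall>x. \<bar>L x\<bar> \<le> norm x)}"
proof -
  let ?P = "{L :: 'e \<Rightarrow> real. \<forall>x. L x \<in> {- norm x .. norm x}}"
  have "closed {L :: 'e \<Rightarrow> real. L (x + y) = L x + L y}" for x y
    by (intro closed_Collect_eq continuous_on_add continuous_on_product_coordinates)
  moreover have "closed {L :: 'e \<Rightarrow> real. L (c *\<^sub>R x) = c *\<^sub>R L x}" for c x
    by (intro closed_Collect_eq continuous_on_scaleR continuous_on_const continuous_on_product_coordinates)
  ultimately have "closed ((\<Inter>x y. {L :: 'e \<Rightarrow> real. L (x + y) = L x + L y}) \<inter>
      (\<Inter>c x. {L. L (c *\<^sub>R x) = c *\<^sub>R L x}))"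
    by (intro closed_Int closed_INT ballI)
  moreover have "compact ?P" by (intro compact_functions_into_compacts) simp
  ultimately have "compact (((\<Inter>x y. {L :: 'e \<Rightarrow> real. L (x + y) = L x + L y}) \<inter>
      (\<Inter>c x. {L. L (c *\<^sub>R x) = c *\<^sub>R L x})) \<inter> ?P)"
    by (rule closed_Int_compact)
  moreover have "((\<Inter>x y. {L :: 'e \<Rightarrow> real. L (x + y) = L x + L y}) \<inter>
      (\<Inter>c x. {L. L (c *\<^sub>R x) = c *\<^sub>R L x})) \<inter> ?P = {L. linear L \<and> (\<forall>x. \<bar>L x\<bar> \<le> norm x)}"
    by (auto simp: linear_iff abs_le_iff minus_le_iff)
  ultimately show ?thesis by simp
qed

lemma weakly_open_not_separating:
  fixes x y :: "'e::real_normed_vector"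
  assumes "openin weak_topology U" and eq: "\<And>\<phi> :: 'e \<Rightarrow>\<^sub>L real. blinfun_apply \<phi> x = blinfun_apply \<phi> y"
  shows "x \<in> U \<longleftrightarrow> y \<in> U"
proof -
  have "generate_topology_on {blinfun_apply \<phi> -` U | (\<phi> :: 'e \<Rightarrow>\<^sub>L real) U. open U} U"
    using assms(1) unfolding weak_topology_def by (rule openin_topology_generated_by)
  then show ?thesis
    by induction (use eq in auto)
qed

text \<open>
The functions are those induced by the dual unit ball. They separate points since otherwise the
weak topology could not separate the points of the copy of the space, which is Hausdorff.
\<close>
lemma eberlein_compact_separating_functions:
  assumes "eberlein_compact_in TYPE('e::banach) TYPE('a::t2_space)"
  shows "\<exists>B :: ('a \<Rightarrow> real) set. compact B \<and> (\<forall>p\<in>B. continuous_on UNIV p) \<and>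
     (\<forall>x y. x \<noteq> y \<longrightarrow> (\<exists>p\<in>B. p x \<noteq> p y))"
proof -
  obtain S :: "'e set" and \<iota> where \<iota>: "homeomorphic_map (euclidean :: 'a topology) (subtopology weak_topology S) \<iota>"
    using assms unfolding eberlein_compact_in_def homeomorphic_space by blast
  let ?L = "{L :: 'e \<Rightarrow> real. linear L \<and> (\<forall>x. \<bar>L x\<bar> \<le> norm x)}"
  let ?B = "(\<lambda>L x. L (\<iota> x)) ` ?L"
  have cont: "continuous_map euclidean weak_topology \<iota>"
    using homeomorphic_imp_continuous_map[OF \<iota>] by (simp add: continuous_map_in_subtopology)
  have "compact ?B"
    by (intro compact_continuous_image compact_dual_ball continuous_on_coordinatewise_then_product
        continuous_on_product_coordinates[THEN continuous_on_subset]) auto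
  moreover have "continuous_on UNIV p" if "p \<in> ?B" for p
  proof -
    obtain L where L: "linear L" "\<And>x. \<bar>L x\<bar> \<le> norm x" "p = (\<lambda>x. L (\<iota> x))" using \<open>p \<in> ?B\<close> by auto
    then have bl: "bounded_linear L"
      by (intro bounded_linear_intro[where K = 1]) (auto simp: linear_add linear_scale)
    have "openin euclidean {x \<in> topspace euclidean. \<iota> x \<in> blinfun_apply (Blinfun L) -` U}" if "open U" for U
      using cont by (rule openin_continuous_map_preimage)
        (use that in \<open>auto simp: weak_topology_def intro!: topology_generated_by_Basis\<close>)
    then have "open (p -` U)" if "open U" for U
      using that bl by (simp add: L(3) bounded_linear_Blinfun_apply vimage_def)
    then show ?thesis by (simp add: continuous_on_open_vimage)
  qed
  moreover have "\<exists>p\<in>?B. p x \<noteq> p y" if "x \<noteq> y" for x y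
  proof (rule ccontr)
    assume none: "\<not> ?thesis"
    have "\<phi> (\<iota> x) = \<phi> (\<iota> y)" for \<phi> :: "'e \<Rightarrow>\<^sub>L real"
    proof (cases "\<phi> = 0")
      case False
      define L where "L = (\<lambda>z. \<phi> z / norm \<phi>)"
      have "linear L"
        by (rule linearI) (simp_all add: L_def blinfun.add_right blinfun.scaleR_right add_divide_distrib)
      moreover have "\<bar>L z\<bar> \<le> norm z" for z
        using False norm_blinfun[of \<phi> z] by (simp add: L_def field_simps)
      ultimately have "(\<lambda>x. L (\<iota> x)) \<in> ?B" by auto
      then have "L (\<iota> x) = L (\<iota> y)" using none by (meson bexI)
      then show ?thesis using False by (simp add: L_def)
    qed simp
    then have U: "\<iota> x \<in> U \<longleftrightarrow> \<iota> y \<in> U" if "openin weak_topology U" for U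
      using weakly_open_not_separating[OF that] by blast
    obtain W where W: "open W" "x \<in> W" "y \<notin> W" using t1_space \<open>x \<noteq> y\<close> by blast
    have "openin (subtopology weak_topology S) (\<iota> ` W)"
      using homeomorphic_imp_open_map[OF \<iota>] W(1) by (simp add: open_map_def)
    then obtain U where "openin weak_topology U" "\<iota> ` W = U \<inter> S" by (auto simp: openin_subtopology)
    moreover have "\<iota> y \<in> S" using homeomorphic_imp_surjective_map[OF \<iota>] by auto
    ultimately have "\<iota> y \<in> \<iota> ` W" using U[of U] W(2) by blast
    then show False using homeomorphic_imp_injective_map[OF \<iota>] W(3) by (auto simp: inj_on_def)
  qed
  ultimately show ?thesis by blast
qed

text \<open>
An exhaustion of the ring generated by \<open>B\<close> and the constants by pointwise compact sets.
\<close>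
fun ring_levels :: "('a \<Rightarrow> real) set \<Rightarrow> nat \<Rightarrow> ('a \<Rightarrow> real) set" where
  "ring_levels B 0 = B \<union> (\<lambda>c x. c) ` {-1..1}"
| "ring_levels B (Suc n) = ring_levels B n \<union>
     (\<lambda>(p, q) x. p x + q x) ` (ring_levels B n \<times> ring_levels B n) \<union>
     (\<lambda>(p, q) x. p x * q x) ` (ring_levels B n \<times> ring_levels B n)"

lemma compact_ring_levels:
  assumes "compact B" shows "compact (ring_levels B n)"
proof (induction n)
  case 0
  have "compact ((\<lambda>c (x::'a). c) ` {-1..1::real})"
    by (intro compact_continuous_image continuous_on_coordinatewise_then_product continuous_on_id) simp
  then show ?case using assms by (simp add: compact_Un)
next
  case (Suc n)
  have "continuous_on UNIV (\<lambda>(p, q) (x::'a). p x + q x :: real)" "continuous_on UNIV (\<lambda>(p, q) (x::'a). p x * q x :: real)"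
    unfolding case_prod_unfold
    by (intro continuous_on_coordinatewise_then_product continuous_on_add continuous_on_mult
        continuous_on_product_then_coordinatewise[OF continuous_on_fst] 
        continuous_on_product_then_coordinatewise[OF continuous_on_snd] continuous_on_id)+
  then show ?case
    using Suc by (auto intro!: compact_Un compact_continuous_image compact_Times intro: continuous_on_subset)
qed

lemma continuous_ring_levels:
  assumes "\<And>p. p \<in> B \<Longrightarrow> continuous_on UNIV p" "p \<in> ring_levels B n"
  shows "continuous_on UNIV p"
  using assms(2) by (induction n arbitrary: p) (auto intro: assms(1) continuous_on_const continuous_on_add continuous_on_mult)

lemma ring_levels_mono: "m \<le> n \<Longrightarrow> ring_levels B m \<subseteq> ring_levels B n"
  by (rule lift_Suc_mono_le[of "ring_levels B"]) auto

text \<open>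
The union of the levels is a ring that contains the constants and separates points, so that the
Stone-Weierstrass theorem applies to it.
\<close>
lemma ring_levels_dense:
  fixes B :: "('a::t2_space \<Rightarrow> real) set"
  assumes K: "compact (UNIV :: 'a set)"
    and B: "\<And>p. p \<in> B \<Longrightarrow> continuous_on UNIV p" "\<And>x y. x \<noteq> y \<Longrightarrow> \<exists>p\<in>B. p x \<noteq> p y"
    and h: "continuous_on UNIV h" and "e > 0"
  shows "\<exists>n. \<exists>p\<in>ring_levels B n. \<forall>x. \<bar>h x - p x\<bar> \<le> e"
proof -
  let ?R = "\<Union>n. ring_levels B n"
  have const: "(\<lambda>x. c) \<in> ring_levels B n" if "\<bar>c\<bar> \<le> 2 ^ n" for n c
    using that
  proof (induction n arbitrary: c)
    case 0
    then show ?case by (auto simp: abs_le_iff)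
  next
    case (Suc n)
    have "(\<lambda>x. c / 2) \<in> ring_levels B n" using Suc.prems by (intro Suc.IH) simp
    then have "(\<lambda>x. c / 2 + c / 2) \<in> ring_levels B (Suc n)"
      by (auto intro!: rev_image_eqI[of "(\<lambda>x. c / 2, \<lambda>x. c / 2)"])
    then show ?case by simp
  qed
  have level: "\<exists>n. p \<in> ring_levels B n \<and> q \<in> ring_levels B n" if pq: "p \<in> ?R" "q \<in> ?R" for p q
  proof -
    obtain k l where "p \<in> ring_levels B k" "q \<in> ring_levels B l" using pq by blast
    then have "p \<in> ring_levels B (max k l)" "q \<in> ring_levels B (max k l)"
      using ring_levels_mono[of k "max k l" B] ring_levels_mono[of l "max k l" B] by auto
    then show ?thesis by blast
  qed
  interpret function_ring_on ?R UNIV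
  proof
    show "compact (UNIV :: 'a set)" by (rule K)
    show "continuous_on UNIV f" if "f \<in> ?R" for f
      using that continuous_ring_levels B(1) by blast
    fix p q assume "p \<in> ?R" "q \<in> ?R"
    from level[OF this] obtain n where n: "p \<in> ring_levels B n" "q \<in> ring_levels B n" by blast
    have "(\<lambda>x. p x + q x) \<in> ring_levels B (Suc n)" "(\<lambda>x. p x * q x) \<in> ring_levels B (Suc n)"
      using n by (auto intro!: rev_image_eqI[of "(p, q)"])
    then show "(\<lambda>x. p x + q x) \<in> ?R" "(\<lambda>x. p x * q x) \<in> ?R" by blast+
  next
    fix c :: real
    obtain n where "\<bar>c\<bar> < 2 ^ n" using real_arch_pow[of 2] by auto
    then show "(\<lambda>_. c) \<in> ?R" using const[of c n] by auto
  next
    fix x y :: 'a assume "x \<noteq> y"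
    then obtain p where "p \<in> B" "p x \<noteq> p y" using B(2) by blast
    moreover have "B \<subseteq> ring_levels B 0" by simp
    ultimately show "\<exists>f\<in>?R. f x \<noteq> f y" by blast
  qed
  obtain F where F: "F \<in> UNIV \<rightarrow> ?R" "uniform_limit UNIV F h sequentially"
    using Stone_Weierstrass[OF h] by blast
  have "\<forall>\<^sub>F n in sequentially. \<forall>x\<in>UNIV. dist (F n x) (h x) < e"
    using uniform_limitD[OF F(2) \<open>e > 0\<close>] .
  then obtain N where N: "\<forall>x. dist (F N x) (h x) < e" by (auto simp: eventually_sequentially)
  obtain n where "F N \<in> ring_levels B n" using F(1) by blast
  moreover have "\<bar>h x - F N x\<bar> \<le> e" for x using N[rule_format, of x] by (simp add: dist_real_def abs_minus_commute)
  ultimately show ?thesis by blast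
qed

text \<open>
A function \<open>g\<close> on the image is put into \<open>H m n\<close> if \<open>g \<circ> f\<close> is uniformly close to a member \<open>p\<close> of
\<open>C n\<close>. No continuity of \<open>g\<close> is demanded, which makes \<open>H m n\<close> compact. For \<open>osc\<close>, a point in the
closure of \<open>Y\<close> is lifted to a point in the closure of \<open>f -` Y\<close>, where \<open>p\<close> is continuous; \<open>g\<close> is
compared with \<open>p\<close> twice, which is the reason for the factor 2 in the denominator.
\<close>
lemma eps_compact_cover_of_image:
  fixes f :: "'a::t2_space \<Rightarrow> 'b::t2_space"
  assumes f: "continuous_on UNIV f" "surj f" and K: "compact (UNIV :: 'a set)"
    and C: "\<And>n. compact (C n)" "\<And>n p. p \<in> C n \<Longrightarrow> continuous_on UNIV p"
    and dense: "\<And>h e. continuous_on UNIV h \<Longrightarrow> e > 0 \<Longrightarrow> \<exists>n. \<exists>p\<in>C n. \<forall>x. \<bar>h x - p x\<bar> \<le> e"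
  shows "eps_compact_cover (\<lambda>m n. {g :: 'b \<Rightarrow> real. \<exists>p\<in>C n. \<forall>x. \<bar>g (f x) - p x\<bar> \<le> 1 / (2 * real (Suc m))})"
    (is "eps_compact_cover ?H")
proof
  show "compact (UNIV :: 'b set)" using f K compact_continuous_image by metis
next
  fix m n
  let ?e = "1 / (2 * real (Suc m))"
  define S where "S = (\<lambda>(p, r) (x::'a). p x + r x :: real) ` (C n \<times> {r. \<forall>x. r x \<in> {- ?e .. ?e}})"
  have "continuous_on UNIV (\<lambda>(p, r) (x::'a). p x + r x :: real)"
    unfolding case_prod_unfold
    by (intro continuous_on_coordinatewise_then_product continuous_on_add
        continuous_on_product_then_coordinatewise[OF continuous_on_fst] 
        continuous_on_product_then_coordinatewise[OF continuous_on_snd] continuous_on_id)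
  moreover have "compact {r :: 'a \<Rightarrow> real. \<forall>x. r x \<in> {- ?e .. ?e}}"
    by (rule compact_functions_into_compacts) simp
  ultimately have S: "compact S"
    unfolding S_def using C(1) by (intro compact_continuous_image compact_Times) (auto intro: continuous_on_subset)
  \<comment> \<open>\<open>S\<close> is the uniform neighbourhood of \<open>C n\<close>, written as a sum of two compact sets\<close>
  have S_iff: "q \<in> S \<longleftrightarrow> (\<exists>p\<in>C n. \<forall>x. \<bar>q x - p x\<bar> \<le> ?e)" for q
  proof
    assume "\<exists>p\<in>C n. \<forall>x. \<bar>q x - p x\<bar> \<le> ?e"
    then obtain p where p: "p \<in> C n" "\<forall>x. \<bar>q x - p x\<bar> \<le> ?e" by blast
    then show "q \<in> S" unfolding S_def
      by (intro rev_image_eqI[of "(p, \<lambda>x. q x - p x)"]) (auto simp: abs_le_iff minus_le_iff)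
  next
    assume "q \<in> S"
    then obtain p r where p: "p \<in> C n" and r: "\<And>x. r x \<in> {- ?e .. ?e}" and q: "q = (\<lambda>x. p x + r x)"
      unfolding S_def by auto
    have "\<bar>q x - p x\<bar> \<le> ?e" for x
      using r[of x] unfolding q atLeastAtMost_iff by linarith
    with p show "\<exists>p\<in>C n. \<forall>x. \<bar>q x - p x\<bar> \<le> ?e" by blast
  qed
  have H: "?H m n = (\<lambda>g x. g (f x)) -` S"
    by (simp only: vimage_def S_iff)
  have "continuous_on UNIV (\<lambda>(g :: 'b \<Rightarrow> real) x. g (f x))"
    by (intro continuous_on_coordinatewise_then_product continuous_on_product_coordinates)
  then have cl: "closed (?H m n)" unfolding H by (intro closed_vimage compact_imp_closed_functions S)
  have cp: "compact ((\<lambda>q y. q (inv f y)) ` S)"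
    by (intro compact_continuous_image S continuous_on_coordinatewise_then_product
        continuous_on_product_coordinates[THEN continuous_on_subset]) auto
  have sub: "?H m n \<subseteq> (\<lambda>q y. q (inv f y)) ` S"
  proof
    fix g assume "g \<in> ?H m n"
    then have "(\<lambda>x. g (f x)) \<in> S" unfolding H by simp
    then show "g \<in> (\<lambda>q y. q (inv f y)) ` S"
      by (intro image_eqI[where x = "\<lambda>x. g (f x)"]) (simp_all add: surj_f_inv_f[OF f(2)])
  qed
  show "compact (?H m n)"
    using closed_Int_compact[OF cl cp] by (simp only: Int_absorb2[OF sub])
next
  fix h :: "'b \<Rightarrow> real" and m assume "continuous_on UNIV h"
  then have "continuous_on UNIV (\<lambda>x. h (f x))" by (rule continuous_on_compose2[OF _ f(1)]) auto
  then show "\<exists>n. h \<in> ?H m n" using dense[of "\<lambda>x. h (f x)" "1 / (2 * real (Suc m))"] by simp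
next
  fix g m n x Y and c \<delta> :: real
  assume "g \<in> ?H m n" and x: "x \<in> closure Y" and Y: "\<forall>y\<in>Y. \<bar>g y - c\<bar> \<le> \<delta>"
  then obtain p where p: "p \<in> C n" "\<And>x. \<bar>g (f x) - p x\<bar> \<le> 1 / (2 * real (Suc m))" by blast
  let ?e = "1 / (2 * real (Suc m))"
  have "closed (f ` closure (f -` Y))"
    by (rule closed_image_compact_t2[OF K f(1) closed_closure])
  moreover have "Y \<subseteq> f ` closure (f -` Y)"
    using closure_subset[of "f -` Y"] surj_image_vimage_eq[OF f(2), of Y] by blast
  ultimately obtain x' where x': "x' \<in> closure (f -` Y)" "x = f x'"
    using x closure_minimal by blast
  have "closed {z. \<bar>p z - c\<bar> \<le> \<delta> + ?e}"
    using C(2)[OF p(1)] by (intro closed_Collect_le continuous_intros)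
  moreover have "\<bar>p z - c\<bar> \<le> \<delta> + ?e" if "f z \<in> Y" for z
    using p(2)[of z] Y that by (smt (verit))
  then have "f -` Y \<subseteq> {z. \<bar>p z - c\<bar> \<le> \<delta> + ?e}" by blast
  ultimately have "\<bar>p x' - c\<bar> \<le> \<delta> + ?e" using x'(1) closure_minimal by blast
  then have "\<bar>g x - c\<bar> \<le> \<delta> + ?e + ?e" using p(2)[of x'] unfolding x'(2) by linarith
  also have "\<dots> = \<delta> + 1 / real (Suc m)" by (simp add: field_simps)
  finally show "\<bar>g x - c\<bar> \<le> \<delta> + 1 / real (Suc m)" .
qed

section \<open>Embedding into the space of null families\<close>

text \<open>
Evaluations at points are bounded functionals and separate functions.
\<close>
lemma Hausdorff_weak_topology_bcontfun:
  "Hausdorff_space (weak_topology :: ('a::topological_space \<Rightarrow>\<^sub>C real) topology)"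
  unfolding Hausdorff_space_def
proof (intro allI impI, elim conjE)
  fix g h :: "'a \<Rightarrow>\<^sub>C real" assume "g \<noteq> h"
  then obtain x where "apply_bcontfun g x \<noteq> apply_bcontfun h x" using bcontfun_eqI by blast
  from hausdorff[OF this] obtain U V
    where UV: "open U" "open V" "apply_bcontfun g x \<in> U" "apply_bcontfun h x \<in> V" "U \<inter> V = {}"
    by auto
  define ev where "ev = Blinfun (\<lambda>h :: 'a \<Rightarrow>\<^sub>C real. apply_bcontfun h x)"
  have ev: "blinfun_apply ev h = apply_bcontfun h x" for h
    by (simp add: ev_def bounded_linear_Blinfun_apply bounded_linear_apply_bcontfun)
  have op: "openin weak_topology (blinfun_apply ev -` W)" if "open W" for W
    using openin_continuous_map_preimage[OF continuous_map_weak_topology_blinfun, of W ev] that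
    by (simp add: vimage_def)
  show "\<exists>U V. openin weak_topology U \<and> openin weak_topology V \<and> g \<in> U \<and> h \<in> V \<and> disjnt U V"
    using op[OF UV(1)] op[OF UV(2)] UV(3-5)
    by (intro exI[of _ "blinfun_apply ev -` U"] exI[of _ "blinfun_apply ev -` V"]) (auto simp: ev disjnt_def)
qed

lemma bcontfun_discreteI: "bounded (range c) \<Longrightarrow> (c :: 'i discrete \<Rightarrow> real) \<in> bcontfun"
  by (auto simp: bcontfun_def continuous_on_open_vimage open_discrete)

text \<open>
The restriction of a functional to \<open>c\<^sub>0\<close> is given by a summable family \<open>b\<close>, so up to \<open>\<epsilon>\<close> on
the unit ball it depends on the coordinates in a finite set \<open>F\<close>.
\<close>
lemma functional_on_c0_nearly_finite:
  fixes \<phi> :: "'i l_infinity \<Rightarrow>\<^sub>L real"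
  assumes "\<epsilon> > 0"
  shows "\<exists>F b. finite F \<and> (\<forall>v. norm v \<le> 1 \<longrightarrow> (\<forall>e>0. finite {i. \<bar>apply_bcontfun v i\<bar> \<ge> e}) \<longrightarrow>
     \<bar>blinfun_apply \<phi> v - (\<Sum>i\<in>F. apply_bcontfun v i * b i)\<bar> \<le> \<epsilon>)"
proof -
  define unit where "unit = (\<lambda>i. Bcontfun (\<lambda>j :: 'i discrete. if j = i then 1 else 0 :: real))"
  have unit: "apply_bcontfun (unit i) j = (if j = i then 1 else 0)" for i j
  proof -
    have "bounded (range (\<lambda>j :: 'i discrete. if j = i then 1 else 0 :: real))"
      by (rule boundedI[of _ 1]) auto
    then show ?thesis
      unfolding unit_def by (subst Bcontfun_inverse) (auto intro: bcontfun_discreteI)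
  qed
  define b where "b = (\<lambda>i. blinfun_apply \<phi> (unit i))"
  define comb where "comb = (\<lambda>G c. \<Sum>i\<in>G. c i *\<^sub>R unit i)"
  have apply_sum: "apply_bcontfun (\<Sum>i\<in>G. f i) j = (\<Sum>i\<in>G. apply_bcontfun (f i) j)"
    for f :: "_ \<Rightarrow> 'i l_infinity" and G j
    using linear_sum[OF bounded_linear.linear[OF bounded_linear_apply_bcontfun]] .
  have comb: "apply_bcontfun (comb G c) j = (if j \<in> G then c j else 0)" if "finite G" for G c j
    using that by (simp add: comb_def apply_sum unit sum.delta if_distrib[of "(*) _"] cong: if_cong)
  have phi_comb: "blinfun_apply \<phi> (comb G c) = (\<Sum>i\<in>G. c i * b i)" for G c
    by (simp add: comb_def b_def blinfun.sum_right blinfun.scaleR_right)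
  have total: "(\<Sum>i\<in>G. \<bar>b i\<bar>) \<le> norm \<phi>" if "finite G" for G
  proof -
    have "norm (comb G (\<lambda>i. sgn (b i))) \<le> 1"
      by (rule norm_bound) (use that in \<open>auto simp: comb sgn_if\<close>)
    then have "norm \<phi> * norm (comb G (\<lambda>i. sgn (b i))) \<le> norm \<phi> * 1" by (intro mult_left_mono) auto
    moreover have "blinfun_apply \<phi> (comb G (\<lambda>i. sgn (b i))) = (\<Sum>i\<in>G. \<bar>b i\<bar>)"
      by (simp add: phi_comb abs_sgn mult.commute)
    ultimately show ?thesis
      using norm_blinfun[of \<phi> "comb G (\<lambda>i. sgn (b i))"] by simp
  qed
  define s where "s = (SUP G\<in>{G. finite G}. \<Sum>i\<in>G. \<bar>b i\<bar>)"
  have bdd: "bdd_above ((\<lambda>G. \<Sum>i\<in>G. \<bar>b i\<bar>) ` {G. finite G})"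
    using total by (intro bdd_aboveI2[of _ _ "norm \<phi>"]) auto
  have "s - \<epsilon> / 2 < (SUP G\<in>{G. finite G}. \<Sum>i\<in>G. \<bar>b i\<bar>)" using \<open>\<epsilon> > 0\<close> by (simp add: s_def)
  then obtain F where F: "finite F" "s - \<epsilon> / 2 < (\<Sum>i\<in>F. \<bar>b i\<bar>)"
    using less_cSUP_iff[OF _ bdd] by blast
  have tail: "(\<Sum>i\<in>G. \<bar>b i\<bar>) \<le> \<epsilon> / 2" if "finite G" "F \<inter> G = {}" for G
  proof -
    have "(\<Sum>i\<in>F. \<bar>b i\<bar>) + (\<Sum>i\<in>G. \<bar>b i\<bar>) = (\<Sum>i\<in>F \<union> G. \<bar>b i\<bar>)"
      using that F(1) by (simp add: sum.union_disjoint)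
    also have "\<dots> \<le> s" unfolding s_def using that F(1) by (intro cSUP_upper bdd) auto
    finally show ?thesis using F(2) by linarith
  qed
  have "\<bar>blinfun_apply \<phi> v - (\<Sum>i\<in>F. apply_bcontfun v i * b i)\<bar> \<le> \<epsilon>"
    if v: "norm v \<le> 1" "\<forall>e>0. finite {i. \<bar>apply_bcontfun v i\<bar> \<ge> e}" for v
  proof -
    define \<eta> where "\<eta> = \<epsilon> / (2 * (norm \<phi> + 1))"
    have "norm \<phi> + 1 > 0" by (simp add: add_nonneg_pos)
    then have \<eta>: "\<eta> > 0" "norm \<phi> * \<eta> \<le> \<epsilon> / 2"
      using \<open>\<epsilon> > 0\<close> by (auto simp: \<eta>_def field_simps)
    define G where "G = {i. \<bar>apply_bcontfun v i\<bar> \<ge> \<eta>} - F"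
    have G: "finite G" "F \<inter> G = {}" using v(2) \<eta>(1) by (auto simp: G_def)
    let ?w = "comb (F \<union> G) (apply_bcontfun v)"
    have "norm (v - ?w) \<le> \<eta>"
      by (rule norm_bound) (use F(1) G(1) \<eta>(1) in \<open>auto simp: comb G_def\<close>)
    then have "norm \<phi> * norm (v - ?w) \<le> norm \<phi> * \<eta>" by (intro mult_left_mono) auto
    then have 1: "\<bar>blinfun_apply \<phi> v - blinfun_apply \<phi> ?w\<bar> \<le> \<epsilon> / 2"
      using norm_blinfun[of \<phi> "v - ?w"] \<eta>(2) by (simp add: blinfun.diff_right)
    have "blinfun_apply \<phi> ?w = (\<Sum>i\<in>F. apply_bcontfun v i * b i) + (\<Sum>i\<in>G. apply_bcontfun v i * b i)"
      using F(1) G by (simp add: phi_comb sum.union_disjoint)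
    moreover have "\<bar>\<Sum>i\<in>G. apply_bcontfun v i * b i\<bar> \<le> (\<Sum>i\<in>G. \<bar>b i\<bar>)"
    proof (rule order_trans[OF sum_abs], rule sum_mono)
      fix i
      have "\<bar>apply_bcontfun v i\<bar> \<le> 1" using norm_bounded[of v i] v(1) by simp
      then show "\<bar>apply_bcontfun v i * b i\<bar> \<le> \<bar>b i\<bar>"
        by (simp add: abs_mult mult_left_le_one_le)
    qed
    ultimately show ?thesis using 1 tail[OF G] by linarith
  qed
  with F(1) show ?thesis by blast
qed

text \<open>
On the unit ball of \<open>c\<^sub>0\<close> every functional is a uniform limit of functionals that depend on
finitely many coordinates, so coordinatewise continuity suffices.
\<close>
lemma weakly_continuous_into_c0:
  fixes u :: "'b::topological_space \<Rightarrow> 'i l_infinity"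
  assumes cont: "\<And>i. continuous_on UNIV (\<lambda>x. apply_bcontfun (u x) i)" and bound: "\<And>x. norm (u x) \<le> 1"
    and c0: "\<And>x e. e > 0 \<Longrightarrow> finite {i. \<bar>apply_bcontfun (u x) i\<bar> \<ge> e}"
  shows "continuous_map euclidean weak_topology u"
proof -
  have phi: "continuous_on UNIV (\<lambda>x. blinfun_apply \<phi> (u x))" for \<phi> :: "'i l_infinity \<Rightarrow>\<^sub>L real"
  proof -
    have "\<exists>h. continuous_on UNIV h \<and> (\<forall>x. \<bar>blinfun_apply \<phi> (u x) - h x\<bar> \<le> 1 / real (Suc n))" for n
    proof -
      have "1 / real (Suc n) > 0" by simp
      from functional_on_c0_nearly_finite[OF this, of \<phi>] obtain F b where Fb: "finite F"
        "\<And>v. norm v \<le> 1 \<Longrightarrow> (\<forall>e>0. finite {i. \<bar>apply_bcontfun v i\<bar> \<ge> e}) \<Longrightarrow>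
           \<bar>blinfun_apply \<phi> v - (\<Sum>i\<in>F. apply_bcontfun v i * b i)\<bar> \<le> 1 / real (Suc n)" by blast
      have "continuous_on UNIV (\<lambda>x. \<Sum>i\<in>F. apply_bcontfun (u x) i * b i)"
        by (intro continuous_intros cont)
      then show ?thesis using Fb(2) bound c0 by blast
    qed
    then obtain h where h: "\<And>n. continuous_on UNIV (h n)"
        "\<And>n x. \<bar>blinfun_apply \<phi> (u x) - h n x\<bar> \<le> 1 / real (Suc n)" by metis
    have "uniform_limit UNIV h (\<lambda>x. blinfun_apply \<phi> (u x)) sequentially"
    proof (rule uniform_limitI)
      fix e :: real assume "e > 0"
      then obtain N where N: "1 / real (Suc N) < e" using nat_approx_posE by blast
      have "dist (h n x) (blinfun_apply \<phi> (u x)) < e" if "n \<ge> N" for n x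
      proof -
        have "1 / real (Suc n) \<le> 1 / real (Suc N)" using that by (intro divide_left_mono) auto
        then show ?thesis using h(2)[of x n] N by (simp add: dist_real_def abs_minus_commute)
      qed
      then show "\<forall>\<^sub>F n in sequentially. \<forall>x\<in>UNIV. dist (h n x) (blinfun_apply \<phi> (u x)) < e"
        by (auto simp: eventually_sequentially)
    qed
    then show ?thesis using h(1) by (intro uniform_limit_theorem[of UNIV h sequentially]) auto
  qed
  show ?thesis
    unfolding weak_topology_def
  proof (rule continuous_on_generated_topo)
    fix U assume "U \<in> {blinfun_apply \<phi> -` U | (\<phi> :: 'i l_infinity \<Rightarrow>\<^sub>L real) U. open U}"
    then obtain \<phi> :: "'i l_infinity \<Rightarrow>\<^sub>L real" and W where U: "U = blinfun_apply \<phi> -` W" "open W" by blast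
    have "open ((\<lambda>x. blinfun_apply \<phi> (u x)) -` W)" using phi U(2) by (rule open_vimage[rotated])
    then show "openin euclidean (u -` U \<inter> topspace euclidean)" by (simp add: U(1) vimage_def)
  next
    have "UNIV \<in> {blinfun_apply \<phi> -` U | (\<phi> :: 'i l_infinity \<Rightarrow>\<^sub>L real) U. open U}"
      by (rule CollectI, rule exI[of _ 0], rule exI[of _ UNIV]) simp
    then show "u ` topspace euclidean \<subseteq> \<Union> {blinfun_apply \<phi> -` U | (\<phi> :: 'i l_infinity \<Rightarrow>\<^sub>L real) U. open U}"
      by blast
  qed
qed

text \<open>
Scaling the functions of the \<open>k\<close>-th part by \<open>1 / Suc k\<close> turns the separating family into a map
into \<open>c\<^sub>0\<close>. The coordinates are indexed by \<open>'b \<times> nat\<close>: a nonzero function \<open>g\<close> is coded by a point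
\<open>w g\<close> at which it does not vanish, together with its part \<open>k\<close> and its number among the finitely
many members of that part that do not vanish at \<open>w g\<close>.
\<close>
lemma eberlein_compact_if_sigma_point_finite:
  fixes \<G> :: "nat \<Rightarrow> ('b::t2_space \<Rightarrow> real) set"
  assumes K: "compact (UNIV :: 'b set)"
    and cont: "\<And>k g. g \<in> \<G> k \<Longrightarrow> continuous_on UNIV g"
    and fin: "\<And>k x. finite {g \<in> \<G> k. g x \<noteq> 0}"
    and sep: "\<And>x y. x \<noteq> y \<Longrightarrow> \<exists>k. \<exists>g\<in>\<G> k. g x \<noteq> g y"
  shows "eberlein_compact_in TYPE(('b \<times> nat) l_infinity) TYPE('b)"
proof -
  define \<Gamma> where "\<Gamma> = {(k, g). g \<in> \<G> k \<and> (\<exists>x. g x \<noteq> 0)}"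
  define w where "w = (\<lambda>g :: 'b \<Rightarrow> real. SOME x. g x \<noteq> 0)"
  define idx where "idx = (\<lambda>(k, g). (w g, prod_encode (k, to_nat_on {g' \<in> \<G> k. g' (w g) \<noteq> 0} g)))"
  have w: "g (w g) \<noteq> 0" if "(k, g) \<in> \<Gamma>" for k g
    using that someI_ex[of "\<lambda>x. g x \<noteq> 0"] by (auto simp: w_def \<Gamma>_def)
  have inj: "inj_on idx \<Gamma>"
  proof (rule inj_onI, clarify)
    fix k g k' g' assume g: "(k, g) \<in> \<Gamma>" "(k', g') \<in> \<Gamma>" "idx (k, g) = idx (k', g')"
    let ?A = "{h \<in> \<G> k. h (w g) \<noteq> 0}"
    have eq: "w g = w g'" "k = k'" "to_nat_on ?A g = to_nat_on ?A g'"
      using g(3) by (auto simp: idx_def prod_encode_eq)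
    have "g \<in> ?A" "g' \<in> ?A" using g(1,2) w[OF g(1)] w[OF g(2)] eq(1,2) by (auto simp: \<Gamma>_def)
    then have "g = g'"
      using eq(3) inj_on_to_nat_on[OF countable_finite[OF fin[of k "w g"]]] by (auto dest: inj_onD)
    then show "k = k' \<and> g = g'" using eq(2) by simp
  qed
  \<comment> \<open>\<open>arctan\<close> bounds the functions while it keeps their zeros and the pairs that they separate\<close>
  define val where "val = (\<lambda>x (k :: nat, g :: 'b \<Rightarrow> real). arctan (g x) / 2 / real (Suc k))"
  define U where "U = (\<lambda>x (i :: ('b \<times> nat) discrete). if of_discrete i \<in> idx ` \<Gamma>
      then val x (inv_into \<Gamma> idx (of_discrete i)) else 0)"
  have val_le: "\<bar>val x (k, g)\<bar> \<le> 1 / real (Suc k)" for x k g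
  proof -
    have "\<bar>arctan (g x)\<bar> \<le> 2" using arctan_bounded[of "g x"] pi_less_4 by (auto simp: abs_le_iff)
    then have "\<bar>arctan (g x) / 2\<bar> / real (Suc k) \<le> 1 / real (Suc k)" by (intro divide_right_mono) auto
    then show ?thesis by (simp add: val_def)
  qed
  have U_idx: "U x (discrete (idx t)) = val x t" if "t \<in> \<Gamma>" for x t
    using that inj by (simp add: U_def discrete_inverse inv_into_f_f)
  have U_cases: "U x i = 0 \<or> (\<exists>t\<in>\<Gamma>. i = discrete (idx t) \<and> U x i = val x t)" for x i
  proof (cases "of_discrete i \<in> idx ` \<Gamma>")
    case True
    then obtain t where "t \<in> \<Gamma>" "of_discrete i = idx t" by blast
    then have "i = discrete (idx t)" by (metis of_discrete_inverse)
    then show ?thesis using U_idx \<open>t \<in> \<Gamma>\<close> by blast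
  qed (simp add: U_def)
  have U_le: "\<bar>U x i\<bar> \<le> 1" for x i
  proof -
    have "1 / real (Suc k) \<le> 1" for k by simp
    then have "\<bar>val x t\<bar> \<le> 1" for t using val_le[of x "fst t" "snd t"] order_trans by fastforce
    then show ?thesis using U_cases[of x i] by auto
  qed
  define u where "u = (\<lambda>x. Bcontfun (U x))"
  have u: "apply_bcontfun (u x) i = U x i" for x i
  proof -
    have "U x \<in> bcontfun" by (intro bcontfun_discreteI boundedI[of _ 1]) (auto simp: U_le)
    then show ?thesis by (simp add: u_def Bcontfun_inverse)
  qed
  have "continuous_on UNIV (\<lambda>x. U x i)" for i
  proof (cases "of_discrete i \<in> idx ` \<Gamma>")
    case True
    then obtain t where t: "t \<in> \<Gamma>" "of_discrete i = idx t" by blast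
    then have "i = discrete (idx t)" by (metis of_discrete_inverse)
    then have "(\<lambda>x. U x i) = (\<lambda>x. arctan (snd t x) / 2 / real (Suc (fst t)))"
      using U_idx[OF t(1)] by (auto simp: val_def case_prod_unfold)
    moreover have "continuous_on UNIV (snd t)" using t(1) cont by (auto simp: \<Gamma>_def)
    then have "continuous_on UNIV (\<lambda>x. arctan (snd t x) / 2 / real (Suc (fst t)))"
      by (intro continuous_intros) auto
    ultimately show ?thesis by (simp only:)
  qed (simp add: U_def)
  moreover have "norm (u x) \<le> 1" for x by (rule norm_bound) (simp add: u U_le)
  moreover have "finite {i. \<bar>U x i\<bar> \<ge> e}" if "e > 0" for x e
  proof -
    obtain N where N: "1 / real (Suc N) < e" using nat_approx_posE[OF \<open>e > 0\<close>] by blast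
    have "{i. \<bar>U x i\<bar> \<ge> e} \<subseteq> (\<lambda>t. discrete (idx t)) ` (SIGMA k:{..N}. {g \<in> \<G> k. g x \<noteq> 0})"
    proof
      fix i assume "i \<in> {i. \<bar>U x i\<bar> \<ge> e}"
      then have big: "\<bar>U x i\<bar> \<ge> e" by simp
      then have "U x i \<noteq> 0" using \<open>e > 0\<close> by auto
      then obtain k g where t: "(k, g) \<in> \<Gamma>" "i = discrete (idx (k, g))" "U x i = val x (k, g)"
        using U_cases[of x i] by auto
      have "g x \<noteq> 0" using \<open>U x i \<noteq> 0\<close> t(3) by (auto simp: val_def)
      moreover have "k \<le> N"
      proof (rule ccontr)
        assume "\<not> k \<le> N"
        then have "1 / real (Suc k) \<le> 1 / real (Suc N)" by (intro divide_left_mono) auto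
        then show False using val_le[of x k g] big t(3) N by linarith
      qed
      ultimately show "i \<in> (\<lambda>t. discrete (idx t)) ` (SIGMA k:{..N}. {g \<in> \<G> k. g x \<noteq> 0})"
        using t(1,2) by (auto simp: \<Gamma>_def)
    qed
    moreover have "finite (SIGMA k:{..N}. {g \<in> \<G> k. g x \<noteq> 0})" using fin by auto
    ultimately show ?thesis by (meson finite_imageI finite_subset)
  qed
  ultimately have cont_u: "continuous_map euclidean weak_topology u"
    by (intro weakly_continuous_into_c0) (simp_all add: u)
  have inj_u: "inj u"
  proof (rule injI, rule ccontr)
    fix x y assume eq: "u x = u y" and "x \<noteq> y"
    then obtain k g where g: "g \<in> \<G> k" "g x \<noteq> g y" using sep by blast
    then have "g x \<noteq> 0 \<or> g y \<noteq> 0" by auto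
    then have "(k, g) \<in> \<Gamma>" using g(1) by (auto simp: \<Gamma>_def)
    then have "val x (k, g) = val y (k, g)" using U_idx u eq by metis
    then show False using g(2) by (simp add: val_def arctan_eq_iff)
  qed
  have compact: "compact_space (euclidean :: 'b topology)" using K by (simp add: compact_space_def)
  have "compactin weak_topology (range u)"
    using image_compactin[OF _ cont_u, of UNIV] K by simp
  moreover have "homeomorphic_map euclidean (subtopology weak_topology (range u)) u"
    by (rule continuous_imp_homeomorphic_map)
      (use compact cont_u inj_u in \<open>auto simp: continuous_map_in_subtopology
          intro: Hausdorff_space_subtopology Hausdorff_weak_topology_bcontfun\<close>)
  ultimately show ?thesis
    using K unfolding eberlein_compact_in_def homeomorphic_space by blast
qed

section \<open>Continuous images of Eberlein compacta\<close>

text \<open>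
The theorem of Benyamini, Rudin and Wage; the covers of functions pass from the domain of \<open>f\<close> to its
image, where they produce the embedding.
\<close>
theorem eberlein_compact_image:
  fixes f :: "'a::t2_space \<Rightarrow> 'b::t2_space"
  assumes f: "continuous_on UNIV f" "surj f" and E: "eberlein_compact_in TYPE('e::banach) TYPE('a)"
  shows "eberlein_compact_in TYPE(('b \<times> nat) l_infinity) TYPE('b)"
proof -
  have K: "compact (UNIV :: 'a set)" using E by (simp add: eberlein_compact_in_def)
  obtain B :: "('a \<Rightarrow> real) set" where B: "compact B" "\<forall>p\<in>B. continuous_on UNIV p"
      "\<forall>x y. x \<noteq> y \<longrightarrow> (\<exists>p\<in>B. p x \<noteq> p y)"
    using eberlein_compact_separating_functions[OF E] by (elim exE conjE) (rule that)
  interpret eps_compact_cover "\<lambda>m n. {g :: 'b \<Rightarrow> real. \<exists>p\<in>ring_levels B n. \<forall>x.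
      \<bar>g (f x) - p x\<bar> \<le> 1 / (2 * real (Suc m))}"
  proof (rule eps_compact_cover_of_image[OF f K])
    show "compact (ring_levels B n)" for n by (rule compact_ring_levels[OF B(1)])
    show "continuous_on UNIV p" if "p \<in> ring_levels B n" for n p
      by (rule continuous_ring_levels[OF _ that]) (simp add: B(2))
    show "\<exists>n. \<exists>p\<in>ring_levels B n. \<forall>x. \<bar>h x - p x\<bar> \<le> e" if "continuous_on UNIV h" "e > 0" for h e
      by (rule ring_levels_dense[OF K _ _ that]) (simp_all add: B(2,3))
  qed
  obtain \<G> :: "nat \<Rightarrow> ('b \<Rightarrow> real) set" where
      "\<forall>k. \<forall>g\<in>\<G> k. continuous_on UNIV g" "\<forall>k x. finite {g \<in> \<G> k. g x \<noteq> 0}"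
      "\<forall>x y. x \<noteq> y \<longrightarrow> (\<exists>k. \<exists>g\<in>\<G> k. g x \<noteq> g y)"
    using sigma_point_finite_separating_functions by (elim exE conjE) (rule that)
  then show ?thesis
    by (intro eberlein_compact_if_sigma_point_finite[OF compact_space, of \<G>]) simp_all
qed

theorem corollary23:
  fixes f :: "'a::t2_space \<Rightarrow> 'b::t2_space"
  assumes "continuous_on UNIV f" and "surj f"
  shows "(eberlein_compact_in TYPE('e::banach) TYPE('a) \<longrightarrow>
            eberlein_compact_in TYPE(('b \<times> nat) l_infinity) TYPE('b)) \<and>
         (talagrand_compact TYPE('a) \<longrightarrow> talagrand_compact TYPE('b)) \<and>
         (gulko_compact TYPE('a) \<longrightarrow> gulko_compact TYPE('b))"
  by (intro conjI impI)
    (rule eberlein_compact_image[OF assms] talagrand_compact_image[OF assms] gulko_compact_image[OF assms], assumption)+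

end
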